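(* Let $g$ be a Riemannian metric on the $2$-torus $\mathbb{T}^2$ and let $g_0$ be its normalized conformally equivalent flat metric, i.e., the flat metric in the conformal class of $g$ such that $g=\varphi\cdot g_0$ with $\varphi\in C^\infty(\mathbb{T}^2)$ positive and $\max_{\mathbb{T}^2}\varphi=1$. Then $\beta_g(h)\le\beta_{g_0}(h)$ for every $h\in H_1(\mathbb{T}^2;\mathbb{R})$. Moreover, equality holds at some $h\in H_1(\mathbb{T}^2;\mathbb{R})\setminus\{0\}$ if and only if $g=g_0$, i.e., $g$ is flat.
   Context: On $\mathbb{T}^2$ every Riemannian metric $g$ is conformally equivalent to a flat metric. The normalized conformally equivalent flat metric associated to $g$ is the flat metric $g_0$ in the conformal class of $g$ such that $\mathcal C_{g_0}(g):=\max_{x}\max_{v\in T_x\mathbb{T}^2,\ g_{0,x}(v,v)=1}g_x(v,v)=1$; writing $g=\varphi\cdot g_0$, this means $\max\varphi=1$. It always exists, since a flat metric remains flat under constant rescaling. Let $M=\mathbb{T}^2$ and let $g$ be any Riemannian metric on $M$; $\|v\|_x=\sqrt{g_x(v,v)}$ for $v\in T_xM$, and $L_g(x,v)=\tfrac12\|v\|_x^2$. $\mathcal M(TM)$ denotes the set of Borel probability measures $\mu$ on $TM$ that are closed, i.e. $\int_{TM} df_x(v)\,d\mu(x,v)=0$ for every $f\in C^1(M)$, and have finite first momentum, i.e. $\int_{TM}\|v\|_x\,d\mu<\infty$ (since $M$ is compact this does not depend on the metric). The rotation vector (Schwartzman asymptotic cycle) of $\mu\in\mathcal M(TM)$ is the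 class $\rho(\mu)\in H_1(M;\mathbb{R})$ determined by $\langle[\eta],\rho(\mu)\rangle=\int_{TM}\eta_x(v)\,d\mu(x,v)$ for every closed smooth 1-form $\eta$ on $M$, where $\langle\cdot,\cdot\rangle$ is the pairing between $H^1(M;\mathbb{R})$ and $H_1(M;\mathbb{R})$. The map $\rho\colon\mathcal M(TM)\to H_1(M;\mathbb{R})$ is surjective. Mather's $\beta$-function of $g$ is $\beta_g(h):=\min_{\mu\in\rho^{-1}(h)}\int_{TM}L_g(x,v)\,d\mu$, $h\in H_1(M;\mathbb{R})$ (the minimum is attained). *)

theory Defs
  imports "HOL-Probability.Probability"
begin

text \<open>
  The torus is the quotient of the plane by the integer lattice, with the quotient topology.
  Its tangent bundle is trivialised by the coordinate fields of the plane, so a tangent vector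
  is a pair consisting of a point of the torus and a vector of the plane.
\<close>

definition lattice_equiv :: "real^2 \<Rightarrow> real^2 \<Rightarrow> bool" where
  "lattice_equiv x y \<longleftrightarrow> (\<forall>i. x $ i - y $ i \<in> \<int>)"

lemma equivp_lattice_equiv: "equivp lattice_equiv"
proof (rule equivpI)
  show "reflp lattice_equiv"
    by (auto simp: reflp_def lattice_equiv_def)
  show "symp lattice_equiv"
    unfolding symp_def lattice_equiv_def by (metis Ints_minus minus_diff_eq)
  show "transp lattice_equiv"
  proof (rule transpI)
    fix x y z :: "real^2"
    assume "lattice_equiv x y" "lattice_equiv y z"
    then have "(x $ i - y $ i) + (y $ i - z $ i) \<in> \<int>" for i
      unfolding lattice_equiv_def by (blast intro: Ints_add)
    then show "lattice_equiv x z"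
      by (simp add: lattice_equiv_def)
  qed
qed

quotient_type torus = "real^2" / lattice_equiv
  by (rule equivp_lattice_equiv)

instantiation torus :: topological_space
begin

definition open_torus :: "torus set \<Rightarrow> bool" where
  "open_torus U \<longleftrightarrow> open (abs_torus -` U)"

instance
  by standard (auto simp: open_torus_def vimage_Int vimage_Union)

end

type_synonym tangent = "torus \<times> (real^2)"
type_synonym one_form = "torus \<Rightarrow> real^2 \<Rightarrow> real"
type_synonym metric = "torus \<Rightarrow> real^2 \<Rightarrow> real^2 \<Rightarrow> real"


subsection \<open>Calculus on the torus\<close>

text \<open>
  The differential is taken on the periodic lift to the plane. The representative of \<open>p\<close> chosen
  by \<open>rep_torus\<close> does not matter, since the lift is invariant under lattice translations.
\<close>

definition differentiable_torus :: "(torus \<Rightarrow> real) \<Rightarrow> bool" where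
  "differentiable_torus f \<longleftrightarrow> (\<forall>x. (\<lambda>y. f (abs_torus y)) differentiable (at x))"

definition differential :: "(torus \<Rightarrow> real) \<Rightarrow> one_form" where
  "differential f p v = frechet_derivative (\<lambda>y. f (abs_torus y)) (at (rep_torus p)) v"

primrec Ck :: "nat \<Rightarrow> (torus \<Rightarrow> real) \<Rightarrow> bool" where
  "Ck 0 f \<longleftrightarrow> continuous_on UNIV f"
| "Ck (Suc k) f \<longleftrightarrow> differentiable_torus f \<and> (\<forall>v. Ck k (\<lambda>p. differential f p v))"

definition smooth :: "(torus \<Rightarrow> real) \<Rightarrow> bool" where
  "smooth f \<longleftrightarrow> (\<forall>k. Ck k f)"

definition smooth_form :: "one_form \<Rightarrow> bool" where
  "smooth_form \<eta> \<longleftrightarrow> (\<forall>p. linear (\<eta> p)) \<and> (\<forall>v. smooth (\<lambda>p. \<eta> p v))"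

text \<open>The exterior derivative of \<open>\<eta>\<close>, evaluated on the constant vector fields \<open>v\<close> and \<open>w\<close>, which commute.\<close>

definition closed_form :: "one_form \<Rightarrow> bool" where
  "closed_form \<eta> \<longleftrightarrow> smooth_form \<eta> \<and>
     (\<forall>p v w. differential (\<lambda>q. \<eta> q w) p v - differential (\<lambda>q. \<eta> q v) p w = 0)"


subsection \<open>Riemannian metrics and curvature\<close>

definition riemannian_metric :: "metric \<Rightarrow> bool" where
  "riemannian_metric g \<longleftrightarrow>
     (\<forall>p. bilinear (g p)) \<and>
     (\<forall>p v w. g p v w = g p w v) \<and>
     (\<forall>p v. v \<noteq> 0 \<longrightarrow> 0 < g p v v) \<and>
     (\<forall>v w. smooth (\<lambda>p. g p v w))"

abbreviation ebasis :: "2 \<Rightarrow> real^2" where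
  "ebasis i \<equiv> axis i 1"

definition gram :: "metric \<Rightarrow> torus \<Rightarrow> real^2^2" where
  "gram g p = (\<chi> i j. g p (ebasis i) (ebasis j))"

definition christoffel :: "metric \<Rightarrow> 2 \<Rightarrow> 2 \<Rightarrow> 2 \<Rightarrow> torus \<Rightarrow> real" where
  "christoffel g k i j p = (1/2) * (\<Sum>l\<in>UNIV. matrix_inv (gram g p) $ k $ l *
     (differential (\<lambda>q. gram g q $ j $ l) p (ebasis i)
      + differential (\<lambda>q. gram g q $ i $ l) p (ebasis j)
      - differential (\<lambda>q. gram g q $ i $ j) p (ebasis l)))"

text \<open>
  The component along \<open>ebasis l\<close> of \<open>R(ebasis i, ebasis j)(ebasis k)\<close>, where
  \<open>R(X, Y) = [\<nabla>\<^sub>X, \<nabla>\<^sub>Y] - \<nabla>\<^bsub>[X, Y]\<^esub>\<close> for the Levi-Civita connection.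
\<close>

definition riemann_curvature :: "metric \<Rightarrow> 2 \<Rightarrow> 2 \<Rightarrow> 2 \<Rightarrow> 2 \<Rightarrow> torus \<Rightarrow> real" where
  "riemann_curvature g l i j k p =
     differential (christoffel g l j k) p (ebasis i) - differential (christoffel g l i k) p (ebasis j)
     + (\<Sum>m\<in>UNIV. christoffel g l i m p * christoffel g m j k p
                - christoffel g l j m p * christoffel g m i k p)"

definition flat_metric :: "metric \<Rightarrow> bool" where
  "flat_metric g \<longleftrightarrow> (\<forall>l i j k p. riemann_curvature g l i j k p = 0)"

definition normalized_conformal_flat :: "metric \<Rightarrow> metric \<Rightarrow> bool" where
  "normalized_conformal_flat g g0 \<longleftrightarrow>
     riemannian_metric g0 \<and> flat_metric g0 \<and>
     (\<exists>\<phi>. smooth \<phi> \<and> (\<forall>p. 0 < \<phi> p) \<and>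
          g = (\<lambda>p v w. \<phi> p * g0 p v w) \<and>
          (\<forall>p. \<phi> p \<le> 1) \<and> (\<exists>p. \<phi> p = 1))"


subsection \<open>Closed measures, rotation vectors and the beta function\<close>

text \<open>
  The finiteness of the first moment does not depend on the metric used to measure tangent
  vectors, by compactness of the torus; the Euclidean one is used.
\<close>

definition closed_measures :: "tangent measure set" where
  "closed_measures = {\<mu>. sets \<mu> = sets borel \<and> prob_space \<mu> \<and>
     integrable \<mu> (\<lambda>(p, v). norm v) \<and>
     (\<forall>f. Ck 1 f \<longrightarrow> (LINT (p, v)|\<mu>. differential f p v) = 0)}"

text \<open>
  The first real homology group of the torus is represented by \<open>real^2\<close>: the vector \<open>h\<close> stands
  for the class of the real cycle \<open>\<Sum>i. h $ i \<cdot> \<gamma> i\<close>, where the loops \<open>\<gamma> i\<close> given by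
  \<open>t \<mapsto> abs_torus (t *\<^sub>R ebasis i)\<close> on \<open>{0..1}\<close> form the standard basis. The pairing of a closed
  form with such a class is integration of the form over the cycle.
\<close>

type_synonym H1 = "real^2"

definition pairing :: "one_form \<Rightarrow> H1 \<Rightarrow> real" where
  "pairing \<eta> h =
     (\<Sum>i\<in>UNIV. h $ i * integral {0..1} (\<lambda>t. \<eta> (abs_torus (t *\<^sub>R ebasis i)) (ebasis i)))"

definition rotation_vector :: "tangent measure \<Rightarrow> H1" where
  "rotation_vector \<mu> =
     (THE h. \<forall>\<eta>. closed_form \<eta> \<longrightarrow> pairing \<eta> h = (LINT (p, v)|\<mu>. \<eta> p v))"

definition metric_norm :: "metric \<Rightarrow> torus \<Rightarrow> real^2 \<Rightarrow> real" where
  "metric_norm g p v = sqrt (g p v v)"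

definition lagrangian :: "metric \<Rightarrow> torus \<Rightarrow> real^2 \<Rightarrow> real" where
  "lagrangian g p v = (1/2) * (metric_norm g p v)\<^sup>2"

text \<open>
  The action of a measure with finite first moment may be infinite, so it is valued in
  \<open>ennreal\<close>. The infimum is a minimum.
\<close>

definition action :: "metric \<Rightarrow> tangent measure \<Rightarrow> ennreal" where
  "action g \<mu> = (\<integral>\<^sup>+ (p, v). ennreal (lagrangian g p v) \<partial>\<mu>)"

definition mather_beta :: "metric \<Rightarrow> H1 \<Rightarrow> ennreal" where
  "mather_beta g h = (INF \<mu> \<in> {\<mu> \<in> closed_measures. rotation_vector \<mu> = h}. action g \<mu>)"

end

theory Submission
  imports Defs
begin

text \<open>
  On a torus with flat metric \<open>g\<^sub>0\<close> the parallel vector fields \<open>X\<close> are globally defined: an orthonormal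
  coframe, whose connection form is closed, is made parallel on the plane by a rotation, and the
  resulting developing map has no rotational holonomy. The measure carried by \<open>X\<close> with density the
  normalized area of \<open>g\<^sub>0\<close> is closed and is calibrated by the closed form \<open>g\<^sub>0(X, \<cdot>)\<close>, hence minimizes the
  action in its class, and every class arises in this way. If \<open>g = \<phi> g\<^sub>0\<close>, the action of this measure
  is multiplied by \<open>A(g) / A(g\<^sub>0)\<close>, because the area density is multiplied by \<open>\<phi>\<close> in dimension two; that
  ratio is less than \<open>1\<close> unless \<open>\<phi> = 1\<close>. If \<open>g\<close> is flat as well, exchanging the roles of the metrics shows
  that the measure carried by \<open>X\<close> also minimizes the action of \<open>g\<close>, so \<open>X\<close> is the parallel field of \<open>g\<close>
  in the same class; its length is constant for both metrics, so \<open>\<phi>\<close> is constant.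
\<close>

text \<open>The pointwise bound \<open>\<phi> \<le> 1\<close> gives the inequality at once; the rest
  serves the rigidity statements. For \<open>g\<close> itself minimizing measures are constructed
  only when \<open>g\<close> is flat, so in general \<open>mather_beta g\<close> is merely bounded
  from above, by testing with a measure that minimizes for \<open>g0\<close>. This settles the
  equality case, since \<open>area g < area g0\<close> would make the bound strict for
  \<open>h \<noteq> 0\<close>. If \<open>g\<close> is flat too, the same bound works in both
  directions.

  The main obstacle lies between \<open>flat_metric\<close>, a local equation in Christoffel
  symbols, and parallel fields on the whole torus. A primitive of the connection form exists on the
  plane but need not be periodic: its increments along the lattice generators are possible holonomy
  angles, which only a global argument excludes.

  All integrals are taken against the one coordinate measure \<open>haar_torus\<close>, so areas of
  different metrics become densities that can be compared pointwise. Closed forms see a closed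
  measure only through its mean velocity, because each of them is a constant-coefficient form plus
  an exact one.\<close>

section \<open>The torus as a compact quotient of the plane\<close>

lemma abs_torus_eq_iff: "abs_torus x = abs_torus y \<longleftrightarrow> lattice_equiv x y"
  by (rule torus.abs_eq_iff)

lemma abs_rep_torus [simp]: "abs_torus (rep_torus p) = p"
  using Quotient_torus by (rule Quotient_abs_rep[OF _]) 

lemma lattice_equiv_rep_abs: "lattice_equiv (rep_torus (abs_torus x)) x"
  by (simp flip: abs_torus_eq_iff)

lemma abs_torus_shift [simp]: "abs_torus (x + axis i 1) = abs_torus x"
  by (auto simp: abs_torus_eq_iff lattice_equiv_def axis_def)

lemma continuous_on_abs_torus [continuous_intros]: "continuous_on S abs_torus"
proof -
  have "continuous_on UNIV abs_torus"
    by (auto simp: continuous_on_open_vimage open_torus_def)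
  then show ?thesis
    by (rule continuous_on_subset) auto
qed

text \<open>Universal property of the quotient topology; it moves continuity questions to periodic
  functions on the plane.\<close>

lemma continuous_on_torus_iff:
  "continuous_on UNIV f \<longleftrightarrow> continuous_on UNIV (\<lambda>x. f (abs_torus x))"
proof
  assume "continuous_on UNIV f"
  then show "continuous_on UNIV (\<lambda>x. f (abs_torus x))"
    by (rule continuous_on_compose2) (auto intro: continuous_on_abs_torus)
next
  assume "continuous_on UNIV (\<lambda>x. f (abs_torus x))"
  then show "continuous_on UNIV f"
    by (simp add: continuous_on_open_vimage open_torus_def vimage_def)
qed

text \<open>Fractional parts pick the representative. The strict upper bound leaves room to the
  right of each coordinate, which \<open>haar_torus_continuous_eq_0\<close> needs to fit an interval
  of positive length into the unit interval.\<close>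

lemma lattice_representative:
  obtains y where "abs_torus y = p" "\<And>i. 0 \<le> y $ i" "\<And>i. y $ i < 1"
proof
  let ?y = "\<chi> i. frac (rep_torus p $ i)"
  have "lattice_equiv ?y (rep_torus p)"
    by (auto simp: lattice_equiv_def frac_def)
  then show "abs_torus ?y = p"
    by (simp flip: abs_torus_eq_iff)
qed (auto simp: frac_lt_1)

lemma compact_torus: "compact (UNIV :: torus set)"
proof -
  have "UNIV \<subseteq> abs_torus ` {x. \<forall>i. 0 \<le> x $ i \<and> x $ i \<le> 1}"
  proof
    fix p :: torus
    obtain y where "abs_torus y = p" "\<And>i. 0 \<le> y $ i" "\<And>i. y $ i < 1"
      using lattice_representative[of p] by blast
    then show "p \<in> abs_torus ` {x. \<forall>i. 0 \<le> x $ i \<and> x $ i \<le> 1}"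
      by (force intro: less_imp_le)
  qed
  moreover have "{x. \<forall>i. 0 \<le> x $ i \<and> x $ i \<le> 1} = cbox (0::real^2) 1"
    by (auto simp: mem_box_cart)
  ultimately have "UNIV = abs_torus ` cbox 0 1" by auto
  then show ?thesis
    by (metis compact_cbox compact_continuous_image continuous_on_abs_torus)
qed

lemma bounded_torus:
  fixes f :: "torus \<Rightarrow> 'a::real_normed_vector"
  assumes "continuous_on UNIV f"
  obtains B where "\<And>p. norm (f p) \<le> B"
proof -
  have "bounded (range f)"
    using assms compact_torus compact_continuous_image compact_imp_bounded by blast
  then show thesis
    using that by (auto simp: bounded_iff)
qed

subsection \<open>Periodic functions on the plane\<close>

lemma periodic_lattice_equiv:
  assumes per: "\<And>x i. f (x + axis i 1) = f (x :: real^2)" and "lattice_equiv x y"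
  shows "f x = f y"
proof -
  have nat: "f (x + of_nat n *\<^sub>R axis i 1) = f x" for x i n
  proof (induction n)
    case (Suc n)
    have "x + of_nat (Suc n) *\<^sub>R axis i 1 = (x + of_nat n *\<^sub>R axis i 1) + axis i 1"
      by (simp add: algebra_simps)
    then show ?case using per Suc by metis
  qed simp
  have int: "f (x + of_int k *\<^sub>R axis i 1) = f x" for x i k
  proof (cases "0 \<le> k")
    case True
    then show ?thesis using nat[of x "nat k" i] by simp
  next
    case False
    then show ?thesis using nat[of "x + of_int k *\<^sub>R axis i 1" "nat (-k)" i] by simp
  qed
  have "\<exists>k. x $ i - y $ i = of_int k" for i
    using assms(2) unfolding lattice_equiv_def by (auto elim: Ints_cases)
  then obtain k where k: "\<And>i. x $ i - y $ i = of_int (k i)"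
    by metis
  have "x = (y + of_int (k 1) *\<^sub>R axis 1 1) + of_int (k 2) *\<^sub>R axis 2 1"
    using k[of 1] k[of 2] by (auto simp: vec_eq_iff forall_2 axis_def)
  then show ?thesis using int by metis
qed

text \<open>This is how functions constructed on the plane descend to the torus: compose with
  \<open>rep_torus\<close>, and the arbitrary choice of representative disappears.\<close>

lemma periodic_lift:
  assumes "\<And>x i. f (x + axis i 1) = f (x :: real^2)"
  shows "f (rep_torus (abs_torus x)) = f x"
  using periodic_lattice_equiv[of f, OF assms lattice_equiv_rep_abs] .

subsection \<open>The differential and the classes of differentiability\<close>

text \<open>\<open>differential\<close> is evaluated at the representative chosen by
  \<open>rep_torus\<close>. Translation by the lattice vector \<open>x - ?r\<close> carries the
  derivative from any other lift of the same point to that one.\<close>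

lemma differential_eqI:
  assumes "((\<lambda>y. f (abs_torus y)) has_derivative f') (at x)"
  shows "differential f (abs_torus x) = f'"
proof -
  let ?r = "rep_torus (abs_torus x)"
  have eq: "abs_torus (y + (x - ?r)) = abs_torus y" for y
    using lattice_equiv_rep_abs[of x]
    by (auto simp: abs_torus_eq_iff lattice_equiv_def) (metis Ints_minus minus_diff_eq)
  have "((\<lambda>y. f (abs_torus y)) \<circ> (\<lambda>y. y + (x - ?r)) has_derivative f' \<circ> (\<lambda>v. v)) (at ?r)"
    by (rule diff_chain_at) (use assms in \<open>auto intro!: derivative_eq_intros\<close>)
  then have "((\<lambda>y. f (abs_torus y)) has_derivative f') (at ?r)"
    by (simp add: o_def eq)
  then show ?thesis
    unfolding differential_def by (metis frechet_derivative_at ext)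
qed

lemma has_derivative_lift:
  assumes "differentiable_torus f"
  shows "((\<lambda>y. f (abs_torus y)) has_derivative differential f (abs_torus x)) (at x)"
  using assms differential_eqI frechet_derivative_works unfolding differentiable_torus_def by metis

lemma differential_linear: "differentiable_torus f \<Longrightarrow> linear (differential f p)"
  by (metis abs_rep_torus has_derivative_lift has_derivative_linear)

lemma vec2_eq: "v = v $ 1 *\<^sub>R axis 1 1 + v $ 2 *\<^sub>R axis 2 (1::real)" for v :: "real^2"
  by (auto simp: vec_eq_iff forall_2 axis_def)

lemma linear_vec2:
  fixes f :: "real^2 \<Rightarrow> 'a::real_vector"
  assumes "linear f" shows "f v = v $ 1 *\<^sub>R f (axis 1 1) + v $ 2 *\<^sub>R f (axis 2 1)"
  by (subst vec2_eq[of v]) (simp add: assms linear_add linear_scale del: scaleR_conv_of_real)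

lemma continuous_differentiable_torus:
  assumes "differentiable_torus f" shows "continuous_on UNIV f"
  unfolding continuous_on_torus_iff
  by (rule has_derivative_continuous_on) (auto intro: has_derivative_at_withinI has_derivative_lift[OF assms])

lemma differentiable_torusI:
  assumes "\<And>x. ((\<lambda>y. f (abs_torus y)) has_derivative f' x) (at x)"
  shows "differentiable_torus f"
  using assms unfolding differentiable_torus_def differentiable_def by blast

lemma has_derivative_lift_rep:
  "differentiable_torus f \<Longrightarrow> ((\<lambda>y. f (abs_torus y)) has_derivative differential f p) (at (rep_torus p))"
  using has_derivative_lift[of f "rep_torus p"] by simp

lemma differential_eqI_rep:
  assumes "((\<lambda>y. f (abs_torus y)) has_derivative f') (at (rep_torus p))"
  shows "differential f p = f'"
  using differential_eqI[OF assms] by simp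

context
  fixes f g :: "torus \<Rightarrow> real"
  assumes f: "differentiable_torus f" and g: "differentiable_torus g"
begin

lemma differentiable_torus_add: "differentiable_torus (\<lambda>p. f p + g p)"
  and differential_add: "differential (\<lambda>p. f p + g p) p v = differential f p v + differential g p v"
   apply (rule differentiable_torusI, rule has_derivative_add[OF has_derivative_lift[OF f] has_derivative_lift[OF g]])
  apply (subst differential_eqI_rep)
   apply (rule has_derivative_add[OF has_derivative_lift_rep[OF f] has_derivative_lift_rep[OF g]])
  by simp

lemma differentiable_torus_mult: "differentiable_torus (\<lambda>p. f p * g p)"
  and differential_mult:
    "differential (\<lambda>p. f p * g p) p v = f p * differential g p v + differential f p v * g p"
   apply (rule differentiable_torusI, rule has_derivative_mult[OF has_derivative_lift[OF f] has_derivative_lift[OF g]])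
  apply (subst differential_eqI_rep)
   apply (rule has_derivative_mult[OF has_derivative_lift_rep[OF f] has_derivative_lift_rep[OF g]])
  by simp

end

lemma differentiable_torus_const: "differentiable_torus (\<lambda>p. c)"
  and differential_const: "differential (\<lambda>p. c) p v = 0"
   apply (rule differentiable_torusI, rule has_derivative_const)
  apply (subst differential_eqI_rep)
   apply (rule has_derivative_const)
  by simp

lemma has_derivative_compose_lift:
  assumes f: "differentiable_torus f"
    and h: "(h has_field_derivative h') (at (f (abs_torus x)))"
  shows "((\<lambda>y. h (f (abs_torus y))) has_derivative (\<lambda>v. h' * differential f (abs_torus x) v)) (at x)"
  using diff_chain_at[OF has_derivative_lift[OF f, of x] h[unfolded has_field_derivative_def]]
  by (simp add: o_def)

lemma differentiable_torus_compose:
  assumes "differentiable_torus f" "\<And>p. (h has_field_derivative h' (f p)) (at (f p))"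
  shows "differentiable_torus (\<lambda>p. h (f p))"
    and "differential (\<lambda>p. h (f p)) p v = h' (f p) * differential f p v"
   apply (rule differentiable_torusI, rule has_derivative_compose_lift[OF assms])
  using differential_eqI[OF has_derivative_compose_lift[OF assms], of "rep_torus p"] by simp

section \<open>Closure properties of the classes \<open>Ck\<close> and of smooth functions\<close>

lemma Ck_Suc_imp: "Ck (Suc k) f \<Longrightarrow> Ck k f"
  by (induction k arbitrary: f) (simp_all add: continuous_differentiable_torus)

lemma Ck_const: "Ck k (\<lambda>p. c)"
proof (induction k arbitrary: c)
  case (Suc k)
  have "(\<lambda>p. differential (\<lambda>p. c) p v) = (\<lambda>p. 0)" for v
    by (simp add: differential_const)
  then show ?case using Suc by (simp add: differentiable_torus_const)
qed simp

lemma Ck_add: "Ck k f \<Longrightarrow> Ck k g \<Longrightarrow> Ck k (\<lambda>p. f p + g p)"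
proof (induction k arbitrary: f g)
  case (Suc k)
  then show ?case by (simp add: differentiable_torus_add differential_add)
qed (auto intro: continuous_intros)

lemma Ck_mult: "Ck k f \<Longrightarrow> Ck k g \<Longrightarrow> Ck k (\<lambda>p. f p * g p)"
proof (induction k arbitrary: f g)
  case (Suc k)
  have "Ck k (\<lambda>p. f p * differential g p v + differential f p v * g p)" for v
    using Suc.prems by (intro Ck_add Suc.IH Ck_Suc_imp[of k f] Ck_Suc_imp[of k g]) auto
  then show ?case using Suc.prems by (simp add: differentiable_torus_mult differential_mult)
qed (auto intro: continuous_intros)

lemma Ck_inverse: "Ck k f \<Longrightarrow> (\<And>p. f p \<noteq> 0) \<Longrightarrow> Ck k (\<lambda>p. inverse (f p))"
proof (induction k arbitrary: f)
  case (Suc k)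
  \<comment> \<open>The derivative of \<open>inverse\<close> is expressed through
    \<open>inverse\<close> itself, so that the induction hypothesis covers it at one order less. The
    square root is treated in the same way below.\<close>
  have d: "(inverse has_field_derivative - (inverse (f p) * inverse (f p))) (at (f p))" for p
    using DERIV_inverse[OF Suc.prems(2)[of p]] by (simp add: power2_eq_square)
  have "Ck k (\<lambda>p. (-1) * (inverse (f p) * inverse (f p)) * differential f p v)" for v
    using Suc.prems by (intro Ck_mult Suc.IH Ck_Suc_imp[of k f] Ck_const) auto
  then show ?case
    using Suc.prems differentiable_torus_compose[of f inverse "\<lambda>y. - (inverse y * inverse y)", OF _ d] by simp
qed (auto intro!: continuous_intros)

lemma Ck_sqrt: "Ck k f \<Longrightarrow> (\<And>p. 0 < f p) \<Longrightarrow> Ck k (\<lambda>p. sqrt (f p))"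
proof (induction k arbitrary: f)
  case (Suc k)
  have d: "(sqrt has_field_derivative inverse (sqrt (f p)) * (1/2)) (at (f p))" for p
    using DERIV_real_sqrt[OF Suc.prems(2)[of p]] by simp
  have "Ck k (\<lambda>p. inverse (sqrt (f p)) * (1/2) * differential f p v)" for v
    using Suc.prems by (intro Ck_mult Suc.IH Ck_inverse Ck_Suc_imp[of k f] Ck_const)
      (auto simp: less_imp_neq[symmetric] less_imp_le intro: Suc.IH Ck_Suc_imp)
  then show ?case
    using Suc.prems differentiable_torus_compose[of f sqrt "\<lambda>y. inverse (sqrt y) * (1/2)", OF _ d]
    by (simp only: Ck.simps simp_thms)
qed (auto intro!: continuous_intros)

lemma smooth_const [simp]: "smooth (\<lambda>p. c)"
  by (simp add: smooth_def Ck_const)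

lemma smooth_add: "smooth f \<Longrightarrow> smooth g \<Longrightarrow> smooth (\<lambda>p. f p + g p)"
  by (simp add: smooth_def Ck_add)

lemma smooth_mult: "smooth f \<Longrightarrow> smooth g \<Longrightarrow> smooth (\<lambda>p. f p * g p)"
  by (simp add: smooth_def Ck_mult)

lemma smooth_diff: "smooth f \<Longrightarrow> smooth g \<Longrightarrow> smooth (\<lambda>p. f p - g p)"
  using smooth_add[of f "\<lambda>p. -1 * g p"] smooth_mult[of "\<lambda>p. -1" g] by simp

lemma smooth_divide:
  "smooth f \<Longrightarrow> smooth g \<Longrightarrow> (\<And>p. g p \<noteq> 0) \<Longrightarrow> smooth (\<lambda>p. f p / g p)"
  using smooth_mult[of f "\<lambda>p. inverse (g p)"] by (simp add: smooth_def Ck_inverse divide_inverse)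

lemma smooth_sqrt: "smooth f \<Longrightarrow> (\<And>p. 0 < f p) \<Longrightarrow> smooth (\<lambda>p. sqrt (f p))"
  by (simp add: smooth_def Ck_sqrt)

lemma smooth_sum: "(\<And>i. i \<in> I \<Longrightarrow> smooth (f i)) \<Longrightarrow> smooth (\<lambda>p. \<Sum>i\<in>I. f i p)"
  by (induction I rule: infinite_finite_induct) (auto intro: smooth_add)

lemma smooth_differentiable: "smooth f \<Longrightarrow> differentiable_torus f"
  unfolding smooth_def by (metis Ck.simps(2))

lemma smooth_continuous: "smooth f \<Longrightarrow> continuous_on UNIV f"
  by (intro continuous_differentiable_torus smooth_differentiable)

lemma smooth_differential: "smooth f \<Longrightarrow> smooth (\<lambda>p. differential f p v)"
  unfolding smooth_def by (metis Ck.simps(2))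

lemmas smooth_intros = smooth_const smooth_add smooth_mult smooth_diff smooth_sum smooth_differential

lemma continuous_on_lift: "continuous_on UNIV f \<Longrightarrow> continuous_on UNIV (\<lambda>x. f (abs_torus x))"
  by (simp flip: continuous_on_torus_iff)

subsection \<open>Closed forms\<close>

text \<open>The potential at \<open>x\<close> is the integral of the form along the segment from the
  origin to \<open>x\<close>. Differentiating under the integral gives the integrand
  \<open>?D\<close>, and \<open>sym\<close> identifies \<open>?D x t v\<close> with the derivative
  in \<open>t\<close> of \<open>t * (A (t *\<^sub>R x) \<bullet> v)\<close>, so the integral over
  the unit interval is \<open>A x \<bullet> v\<close>.\<close>

lemma poincare_plane:
  fixes A :: "'a::euclidean_space \<Rightarrow> 'a"
  assumes A: "\<And>x. (A has_derivative A' x) (at x)"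
    and cont: "\<And>v. continuous_on UNIV (\<lambda>x. A' x v)"
    and sym: "\<And>x u v. A' x u \<bullet> v = A' x v \<bullet> u"
  obtains \<theta> where "\<And>x. (\<theta> has_derivative (\<lambda>v. A x \<bullet> v)) (at x)"
proof -
  let ?f = "\<lambda>x (t::real). A (t *\<^sub>R x) \<bullet> x"
  let ?D = "\<lambda>x t v. A (t *\<^sub>R x) \<bullet> v + t * (A' (t *\<^sub>R x) v \<bullet> x)"
  define fx where "fx x t = Blinfun (?D x t)" for x t
  have bl: "bounded_linear (A' x)" for x
    using A has_derivative_bounded_linear by blast
  have blD: "bounded_linear (?D x t)" for x t
    by (intro bounded_linear_add bounded_linear_inner_right bounded_linear_const_mult
        bounded_linear_compose[OF bounded_linear_inner_left bl])
  then have fx: "blinfun_apply (fx x t) = ?D x t" for x t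
    by (simp add: fx_def bounded_linear_Blinfun_apply)
  have cA: "continuous_on S A" for S
    by (rule has_derivative_continuous_on) (rule has_derivative_at_withinI[OF A])
  have cA': "continuous_on S (\<lambda>z. A' (h z) v)" if "continuous_on S h" for S v and h :: "'b::topological_space \<Rightarrow> 'a"
    by (rule continuous_on_compose2[OF cont that]) auto
  have cAh: "continuous_on S (\<lambda>z. A (h z))" if "continuous_on S h" for S and h :: "'b::topological_space \<Rightarrow> 'a"
    by (rule continuous_on_compose2[OF cA that]) auto
  define \<theta> where "\<theta> x = integral (cbox (0::real) 1) (?f x)" for x
  have deriv: "(\<theta> has_derivative integral (cbox (0::real) 1) (fx x)) (at x)" for x
    unfolding \<theta>_def
  proof (rule leibniz_rule)
    show "((\<lambda>x. ?f x t) has_derivative blinfun_apply (fx x t)) (at x)" for x t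
    proof -
      have "((\<lambda>x. A (t *\<^sub>R x)) has_derivative (\<lambda>v. A' (t *\<^sub>R x) (t *\<^sub>R v))) (at x)"
        by (rule has_derivative_compose[OF _ A]) (auto intro!: derivative_eq_intros)
      then have "((\<lambda>x. ?f x t) has_derivative (\<lambda>v. A (t *\<^sub>R x) \<bullet> v + A' (t *\<^sub>R x) (t *\<^sub>R v) \<bullet> x)) (at x)"
        by (rule has_derivative_inner) (rule has_derivative_ident)
      then show ?thesis
        by (simp add: fx linear_simps(5)[OF bl])
    qed
    show "?f x integrable_on cbox (0::real) 1" for x
      by (intro integrable_continuous continuous_intros cAh)
    show "continuous_on (UNIV \<times> cbox (0::real) 1) (\<lambda>(x, t). fx x t)"
      unfolding split_beta
      by (rule continuous_on_blinfun_componentwise) (auto simp: fx intro!: continuous_intros cAh cA')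
  qed auto
  have cfx: "continuous_on (cbox (0::real) 1) (fx x)" for x
    by (rule continuous_on_blinfun_componentwise) (auto simp: fx intro!: continuous_intros cAh cA')
  have "blinfun_apply (integral (cbox (0::real) 1) (fx x)) v = A x \<bullet> v" for x v
  proof -
    have "blinfun_apply (integral (cbox (0::real) 1) (fx x)) v = integral (cbox (0::real) 1) (\<lambda>t. fx x t v)"
      by (rule blinfun_apply_integral) (rule integrable_continuous[OF cfx])
    moreover have "((\<lambda>t. fx x t v) has_integral (1 *\<^sub>R (A (1 *\<^sub>R x) \<bullet> v) - 0 *\<^sub>R (A (0 *\<^sub>R x) \<bullet> v))) (cbox (0::real) 1)"
      unfolding cbox_interval
    proof (rule fundamental_theorem_of_calculus)
      fix t :: real
      have "((\<lambda>t. A (t *\<^sub>R x)) has_derivative (\<lambda>s. A' (t *\<^sub>R x) (s *\<^sub>R x))) (at t)"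
        by (rule has_derivative_compose[OF _ A]) (auto intro!: derivative_eq_intros)
      then have "((\<lambda>t. t *\<^sub>R (A (t *\<^sub>R x) \<bullet> v)) has_derivative
          (\<lambda>s. t *\<^sub>R (A' (t *\<^sub>R x) (s *\<^sub>R x) \<bullet> v) + s *\<^sub>R (A (t *\<^sub>R x) \<bullet> v))) (at t)"
        by (auto intro!: derivative_eq_intros)
      moreover have "A' (t *\<^sub>R x) (s *\<^sub>R x) = s *\<^sub>R A' (t *\<^sub>R x) x" for s
        by (simp add: bl linear_simps)
      ultimately show "((\<lambda>t. t *\<^sub>R (A (t *\<^sub>R x) \<bullet> v)) has_vector_derivative fx x t v) (at t within {0..1})"
        unfolding has_vector_derivative_def fx
        by (auto intro!: has_derivative_at_withinI elim!: has_derivative_eq_rhs simp: sym[of _ x v] algebra_simps fun_eq_iff)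
    qed auto
    ultimately show ?thesis
      by (simp add: integral_unique)
  qed
  note eq = this
  have "(\<theta> has_derivative (\<lambda>v. A x \<bullet> v)) (at x)" for x
    by (rule has_derivative_eq_rhs[OF deriv]) (rule ext, rule eq)
  then show thesis by (rule that)
qed

lemma poincare_plane2:
  fixes f1 f2 :: "real^2 \<Rightarrow> real"
  assumes f1: "\<And>x. (f1 has_derivative f1' x) (at x)" and f2: "\<And>x. (f2 has_derivative f2' x) (at x)"
    and cont1: "\<And>v. continuous_on UNIV (\<lambda>x. f1' x v)" and cont2: "\<And>v. continuous_on UNIV (\<lambda>x. f2' x v)"
    and sym: "\<And>x. f1' x (axis 2 1) = f2' x (axis 1 1)"
  obtains \<theta> where "\<And>x. (\<theta> has_derivative (\<lambda>v. f1 x * v $ 1 + f2 x * v $ 2)) (at x)"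
proof -
  let ?A = "\<lambda>x. f1 x *\<^sub>R axis 1 1 + f2 x *\<^sub>R axis 2 1 :: real^2"
  let ?A' = "\<lambda>x v. f1' x v *\<^sub>R axis 1 1 + f2' x v *\<^sub>R axis 2 1 :: real^2"
  have lin: "linear (f1' x)" "linear (f2' x)" for x
    using f1 f2 has_derivative_linear by blast+
  have "?A' x u \<bullet> v = ?A' x v \<bullet> u" for x u v
    by (subst (1 2) linear_vec2[OF lin(1)], subst (1 2) linear_vec2[OF lin(2)])
      (simp add: inner_add_left inner_axis' sym algebra_simps)
  moreover have "(?A has_derivative ?A' x) (at x)" for x
    by (intro derivative_intros f1 f2)
  moreover have "continuous_on UNIV (\<lambda>x. ?A' x v)" for v
    by (intro continuous_intros cont1 cont2)
  ultimately obtain \<theta> where "\<And>x. (\<theta> has_derivative (\<lambda>v. ?A x \<bullet> v)) (at x)"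
    using poincare_plane[of ?A ?A'] by blast
  then show thesis
    by (intro that) (simp add: inner_add_left inner_axis' )
qed

text \<open>Meant for a primitive and its translate by a lattice generator: periodicity of the form
  makes the derivatives agree, and the constant is the period.\<close>

lemma constant_difference:
  fixes f g :: "real^2 \<Rightarrow> 'a::real_normed_vector"
  assumes "\<And>x. (f has_derivative f' x) (at x)" and "\<And>x. (g has_derivative f' x) (at x)"
  obtains c where "\<And>x. f x = g x + c"
proof -
  have "((\<lambda>x. f x - g x) has_derivative (\<lambda>v. 0)) (at x)" for x
    using has_derivative_diff[OF assms] by simp
  then obtain c where "\<And>x. f x - g x = c"
    using has_derivative_zero_constant[of UNIV "\<lambda>x. f x - g x"] by auto
  then show thesis by (metis that add.commute diff_add_cancel)
qed

lemma has_derivative_shift: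
  fixes f :: "'a::real_normed_vector \<Rightarrow> 'b::real_normed_vector"
  assumes "(f has_derivative f') (at (x + a))"
  shows "((\<lambda>x. f (x + a)) has_derivative f') (at x)"
  using diff_chain_at[of "\<lambda>x. x + a" "\<lambda>v. v" x f f'] assms by (simp add: o_def has_derivative_add_const)

lemma linear_pairing: "linear (pairing \<eta>)"
  by (auto simp: linear_iff pairing_def sum_2 algebra_simps)

lemma axis_nth2 [simp]:
  "axis (1::2) (a::real) $ 1 = a" "axis (1::2) a $ 2 = 0" "axis (2::2) a $ 1 = 0" "axis (2::2) a $ 2 = a"
  by (auto simp: axis_def)

lemma pairing_axis: "pairing \<eta> (axis i 1) = integral {0..1} (\<lambda>t. \<eta> (abs_torus (t *\<^sub>R axis i 1)) (axis i 1))"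
  using exhaust_2[of i] by (auto simp: pairing_def sum_2)

text \<open>First de Rham cohomology of the torus: subtracting the linear function
  \<open>pairing \<eta>\<close> from a primitive on the plane kills its increments along both
  generators, so the difference descends to a function on the torus.\<close>

lemma closed_form_exact:
  assumes "closed_form \<eta>"
  obtains f where "Ck 1 f" "\<And>p v. \<eta> p v = differential f p v + pairing \<eta> v"
proof -
  have lin: "linear (\<eta> p)" and sm: "smooth (\<lambda>p. \<eta> p v)" for p v
    using assms by (auto simp: closed_form_def smooth_form_def)
  note dt = smooth_differentiable[OF sm]
  have ct: "continuous_on UNIV (\<lambda>x. differential (\<lambda>p. \<eta> p v) (abs_torus x) w)" for v w
    using smooth_continuous[OF smooth_differential[OF sm]] by (rule continuous_on_lift)
  have cl: "differential (\<lambda>q. \<eta> q w) p v = differential (\<lambda>q. \<eta> q v) p w" for p v w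
    using assms by (simp add: closed_form_def)
  obtain \<theta> where th0: "\<And>x. (\<theta> has_derivative
      (\<lambda>v. \<eta> (abs_torus x) (axis 1 1) * v $ 1 + \<eta> (abs_torus x) (axis 2 1) * v $ 2)) (at x)"
    by (rule poincare_plane2[OF has_derivative_lift[OF dt] has_derivative_lift[OF dt]])
      (auto simp: cl intro: ct)
  have th: "(\<theta> has_derivative \<eta> (abs_torus x)) (at x)" for x
    by (rule has_derivative_eq_rhs[OF th0], rule ext, subst (3) linear_vec2[OF lin]) (simp add: mult.commute)
  define F where "F x = \<theta> x - pairing \<eta> x" for x
  have dF: "(F has_derivative (\<lambda>v. \<eta> (abs_torus x) v - pairing \<eta> v)) (at x)" for x
    unfolding F_def by (rule has_derivative_diff[OF th linear_imp_has_derivative[OF linear_pairing]])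
  have per: "F (x + axis i 1) = F x" for x i
  proof -
    have "((\<lambda>x. F (x + axis i 1)) has_derivative (\<lambda>v. \<eta> (abs_torus x) v - pairing \<eta> v)) (at x)" for x
      using has_derivative_shift[OF dF[of "x + axis i 1"]] by simp
    then obtain c where c: "\<And>x. F (x + axis i 1) = F x + c"
      by (rule constant_difference[OF _ dF]) blast
    have "((\<lambda>t. \<eta> (abs_torus (t *\<^sub>R axis i 1)) (axis i 1)) has_integral
        (\<theta> (1 *\<^sub>R axis i 1) - \<theta> (0 *\<^sub>R axis i 1))) {0..1}"
    proof (rule fundamental_theorem_of_calculus)
      fix t :: real
      have "((\<lambda>t. \<theta> (t *\<^sub>R axis i 1)) has_derivative (\<lambda>s. \<eta> (abs_torus (t *\<^sub>R axis i 1)) (s *\<^sub>R axis i 1))) (at t)"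
        by (rule has_derivative_compose[OF _ th]) (auto intro!: derivative_eq_intros)
      then show "((\<lambda>t. \<theta> (t *\<^sub>R axis i 1)) has_vector_derivative
          \<eta> (abs_torus (t *\<^sub>R axis i 1)) (axis i 1)) (at t within {0..1})"
        unfolding has_vector_derivative_def linear_cmul[OF lin]
        by (rule has_derivative_at_withinI)
    qed auto
    then have "pairing \<eta> (axis i 1) = \<theta> (axis i 1) - \<theta> 0"
      by (simp add: pairing_axis integral_unique)
    then have "c = 0"
      using c[of 0] by (simp add: F_def linear_0[OF linear_pairing])
    then show ?thesis using c by simp
  qed
  define f where "f p = F (rep_torus p)" for p
  have f: "f (abs_torus x) = F x" for x
    unfolding f_def by (rule periodic_lift[OF per])
  have df: "((\<lambda>x. f (abs_torus x)) has_derivative (\<lambda>v. \<eta> (abs_torus x) v - pairing \<eta> v)) (at x)" for x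
    using dF by (simp add: f)
  have D: "differential f p v = \<eta> p v - pairing \<eta> v" for p v
    using differential_eqI[OF df, of "rep_torus p"] by simp
  have "Ck 1 f"
    using differentiable_torusI[OF df] by (auto simp: D intro!: smooth_continuous smooth_diff sm)
  with D show thesis by (intro that) auto
qed

subsection \<open>The Levi-Civita connection in coordinates\<close>

lemma matrix_inv_det:
  fixes A :: "real^'n^'n"
  assumes "det A \<noteq> 0"
  shows "A ** matrix_inv A = mat 1" "matrix_inv A ** A = mat 1"
proof -
  have "A ** matrix_inv A = mat 1 \<and> matrix_inv A ** A = mat 1"
    unfolding matrix_inv_def using assms invertible_det_nz[of A]
    unfolding invertible_def by (metis (mono_tags, lifting) someI_ex)
  then show "A ** matrix_inv A = mat 1" "matrix_inv A ** A = mat 1" by auto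
qed

lemma matrix_inv_2:
  fixes A :: "real^2^2"
  assumes "det A \<noteq> 0"
  shows "matrix_inv A = (1 / det A) *\<^sub>R vector [vector [A$2$2, - (A$1$2)], vector [- (A$2$1), A$1$1]]"
    (is "_ = ?B")
proof -
  define d where "d = det A"
  have d: "A$1$1 * A$2$2 = d + A$1$2 * A$2$1" "d \<noteq> 0"
    using assms by (auto simp: d_def det_2)
  have B: "A ** ?B = mat 1"
    unfolding d_def[symmetric] using d
    by (auto simp: vec_eq_iff forall_2 matrix_matrix_mult_def sum_2 mat_def vector_2 field_simps)
  have "matrix_inv A = matrix_inv A ** (A ** ?B)" "matrix_inv A ** (A ** ?B) = ?B"
    by (simp add: B) (simp add: matrix_mul_assoc matrix_inv_det[OF assms])
  then show ?thesis by simp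
qed

context
  fixes g :: metric
  assumes g: "riemannian_metric g"
begin

lemma metric_bilinear: "bilinear (g p)"
  and metric_commute: "g p v w = g p w v"
  and metric_pos: "v \<noteq> 0 \<Longrightarrow> 0 < g p v v"
  and metric_smooth: "smooth (\<lambda>p. g p v w)"
  using g by (auto simp: riemannian_metric_def)

lemma metric_nonneg: "0 \<le> g p v v"
  using metric_pos[of v p] metric_bilinear[of p] by (cases "v = 0") (auto simp: bilinear_lzero)

lemma gram_smooth: "smooth (\<lambda>p. gram g p $ i $ j)"
  by (simp add: gram_def metric_smooth)

lemma gram_commute: "gram g p $ i $ j = gram g p $ j $ i"
  by (simp add: gram_def metric_commute)

lemma metric_gram: "g p v w = (\<Sum>i\<in>UNIV. \<Sum>j\<in>UNIV. v $ i * w $ j * gram g p $ i $ j)"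
  by (subst vec2_eq[of v], subst vec2_eq[of w])
    (simp add: sum_2 gram_def bilinear_ladd[OF metric_bilinear] bilinear_radd[OF metric_bilinear]
      bilinear_lmul[OF metric_bilinear] bilinear_rmul[OF metric_bilinear] algebra_simps)

lemma gram_11_pos: "0 < gram g p $ 1 $ 1"
  by (simp add: gram_def metric_pos axis_eq_0_iff)

lemma det_gram_pos: "0 < det (gram g p)"
proof -
  let ?G = "gram g p"
  \<comment> \<open>The second basis vector made orthogonal to the first, scaled by
    \<open>?G $ 1 $ 1\<close> to avoid a division. Its squared length is \<open>?G $ 1 $ 1\<close>
    times the determinant.\<close>
  define w where "w = ?G $ 1 $ 1 *\<^sub>R axis 2 1 - ?G $ 1 $ 2 *\<^sub>R axis (1::2) (1::real)"
  have "w $ 2 \<noteq> 0"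
    using gram_11_pos[of p] by (simp add: w_def)
  then have "0 < g p w w"
    by (intro metric_pos) auto
  also have "g p w w = ?G $ 1 $ 1 * det ?G"
    by (simp add: metric_gram sum_2 w_def det_2 gram_commute[of p 2 1] algebra_simps power2_eq_square)
  finally show ?thesis
    using gram_11_pos[of p] zero_less_mult_pos by blast
qed

lemma det_gram_smooth: "smooth (\<lambda>p. det (gram g p))"
  unfolding det_2 by (intro smooth_intros gram_smooth)

lemma matrix_inv_gram_smooth: "smooth (\<lambda>p. matrix_inv (gram g p) $ i $ j)"
proof -
  have "smooth (\<lambda>p. 1 / det (gram g p) * (vector [vector [gram g p$2$2, - (gram g p$1$2)],
      vector [- (gram g p$2$1), gram g p$1$1]] :: real^2^2) $ i $ j)"
    using exhaust_2[of i] exhaust_2[of j] smooth_diff[OF smooth_const[of 0] gram_smooth]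
    by (auto simp: less_imp_neq[symmetric, OF det_gram_pos]
        intro!: smooth_mult smooth_divide smooth_const det_gram_smooth gram_smooth)
  then show ?thesis
    by (simp add: matrix_inv_2 less_imp_neq[symmetric, OF det_gram_pos])
qed

lemma gram_matrix_inv:
  "(\<Sum>k\<in>UNIV. gram g p $ l $ k * matrix_inv (gram g p) $ k $ m) = (if l = m then 1 else 0)"
proof -
  have "gram g p ** matrix_inv (gram g p) = mat 1"
    using det_gram_pos[of p] by (intro matrix_inv_det) simp
  then have "(gram g p ** matrix_inv (gram g p)) $ l $ m = mat 1 $ l $ m" by simp
  then show ?thesis
    by (simp add: matrix_matrix_mult_def mat_def)
qed

lemma christoffel_smooth: "smooth (christoffel g k i j)"
  unfolding christoffel_def by (intro smooth_intros matrix_inv_gram_smooth gram_smooth)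

lemma christoffel_commute: "christoffel g k i j p = christoffel g k j i p"
proof -
  have "(\<lambda>q. gram g q $ i $ j) = (\<lambda>q. gram g q $ j $ i)" by (simp add: gram_commute)
  then show ?thesis
    unfolding christoffel_def by (intro arg_cong2[where f="(*)"] sum.cong refl) simp
qed

text \<open>Lowering the upper index cancels \<open>matrix_inv\<close> and leaves the Christoffel
  symbols of the first kind.\<close>

lemma lowered_christoffel:
  "(\<Sum>k\<in>UNIV. gram g p $ l $ k * christoffel g k i j p) = (1/2) *
     (differential (\<lambda>q. gram g q $ j $ l) p (axis i 1) + differential (\<lambda>q. gram g q $ i $ l) p (axis j 1)
      - differential (\<lambda>q. gram g q $ i $ j) p (axis l 1))"
proof -
  define T where "T m = differential (\<lambda>q. gram g q $ j $ m) p (axis i 1)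
    + differential (\<lambda>q. gram g q $ i $ m) p (axis j 1) - differential (\<lambda>q. gram g q $ i $ j) p (axis m 1)" for m
  have "(\<Sum>k\<in>UNIV. gram g p $ l $ k * christoffel g k i j p)
      = (1/2) * (\<Sum>m\<in>UNIV. (\<Sum>k\<in>UNIV. gram g p $ l $ k * matrix_inv (gram g p) $ k $ m) * T m)"
    unfolding christoffel_def T_def[symmetric] by (simp add: sum_2 algebra_simps)
  also have "\<dots> = (1/2) * T l"
    unfolding gram_matrix_inv by (simp add: if_distrib[of "\<lambda>x. x * _"] cong: if_cong)
  finally show ?thesis by (simp only: T_def)
qed

text \<open>In the sum of the two symbols of the first kind with \<open>j\<close> and
  \<open>l\<close> exchanged, the derivatives in the directions \<open>j\<close> and
  \<open>l\<close> cancel.\<close>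

lemma metric_compatible:
  "differential (\<lambda>q. gram g q $ j $ l) p (axis i 1) =
     (\<Sum>k\<in>UNIV. gram g p $ l $ k * christoffel g k i j p) + (\<Sum>k\<in>UNIV. gram g p $ j $ k * christoffel g k i l p)"
proof -
  have "(\<lambda>q. gram g q $ i $ j) = (\<lambda>q. gram g q $ j $ i)" for i j by (simp add: gram_commute)
  from this[of j l] this[of j i] this[of l i] show ?thesis
    unfolding lowered_christoffel by (simp add: field_simps)
qed

end

text \<open>The columns of the Cholesky factor of the Gram matrix are read as the complex numbers \<open>a j + i b j\<close>,
  and the rotations of the plane act by multiplication; \<open>\<omega>\<close> is the connection form.\<close>

lemma flat_orthonormal_frame:
  assumes g: "riemannian_metric g" and flat: "flat_metric g"
  obtains a b \<omega> :: "2 \<Rightarrow> torus \<Rightarrow> real" where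
    "\<And>j. smooth (a j)" "\<And>j. smooth (b j)" "\<And>j. smooth (\<omega> j)"
    "\<And>p. b 1 p = 0" "\<And>p. 0 < a 1 p" "\<And>p. 0 < b 2 p"
    "\<And>p i j. gram g p $ i $ j = a i p * a j p + b i p * b j p"
    "\<And>p i j. differential (a j) p (axis i 1) = (\<Sum>k\<in>UNIV. a k p * christoffel g k i j p) + \<omega> i p * b j p"
    "\<And>p i j. differential (b j) p (axis i 1) = (\<Sum>k\<in>UNIV. b k p * christoffel g k i j p) - \<omega> i p * a j p"
    "\<And>p. differential (\<omega> 1) p (axis 2 1) = differential (\<omega> 2) p (axis 1 1)"
proof -
  define \<Gamma> where "\<Gamma> = christoffel g"
  define G where "G i j p = gram g p $ i $ j" for i j p
  define a1 where "a1 p = sqrt (G 1 1 p)" for p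
  define a2 where "a2 p = G 1 2 p / a1 p" for p
  define b2 where "b2 p = sqrt (det (gram g p)) / a1 p" for p
  \<comment> \<open>This choice is forced: the second form has no component along the first basis
    vector, so its structure equation for \<open>j = 1\<close> reads
    \<open>0 = b2 p * \<Gamma> 2 i 1 p - \<omega> i p * a1 p\<close>.\<close>
  define \<omega> where "\<omega> i p = b2 p * \<Gamma> 2 i 1 p / a1 p" for i p
  have a1: "0 < a1 p" for p
    by (simp add: a1_def G_def gram_11_pos[OF g])
  have b2: "0 < b2 p" for p
    by (simp add: b2_def a1 det_gram_pos[OF g])
  have nz: "a1 p \<noteq> 0" "b2 p \<noteq> 0" for p
    using a1[of p] b2[of p] by auto
  have sG: "smooth (G i j)" for i j
    unfolding G_def by (rule gram_smooth[OF g])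
  have s\<Gamma>: "smooth (\<Gamma> k i j)" for k i j
    unfolding \<Gamma>_def by (rule christoffel_smooth[OF g])
  have sa1: "smooth a1"
    unfolding a1_def by (intro smooth_sqrt sG) (simp add: G_def gram_11_pos[OF g])
  have sa2: "smooth a2"
    unfolding a2_def by (intro smooth_divide sG sa1 nz)
  have sb2: "smooth b2"
    unfolding b2_def by (intro smooth_divide smooth_sqrt det_gram_smooth[OF g] det_gram_pos[OF g] sa1 nz)
  have s\<omega>: "smooth (\<omega> i)" for i
    unfolding \<omega>_def by (intro smooth_divide smooth_mult sb2 s\<Gamma> sa1 nz)
  note dt = smooth_differentiable[OF sa1] smooth_differentiable[OF sa2] smooth_differentiable[OF sb2]
    smooth_differentiable[OF s\<omega>] smooth_differentiable[OF s\<Gamma>]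
  have Gsym: "G 2 1 p = G 1 2 p" for p
    by (simp add: G_def gram_commute[OF g])
  have G11: "G 1 1 p = a1 p * a1 p" for p
    using gram_11_pos[OF g, of p] by (simp add: a1_def G_def)
  have G12: "G 1 2 p = a1 p * a2 p" for p
    by (simp add: a2_def nz)
  have G22: "G 2 2 p = a2 p * a2 p + b2 p * b2 p" for p
  proof -
    have "(a1 p * b2 p) * (a1 p * b2 p) = G 1 1 p * G 2 2 p - G 1 2 p * G 1 2 p"
      using det_gram_pos[OF g, of p] Gsym[of p] by (simp add: b2_def nz det_2 G_def)
    then have "(a1 p * a1 p) * (b2 p * b2 p + a2 p * a2 p) = (a1 p * a1 p) * G 2 2 p"
      unfolding G11 G12 by (simp add: algebra_simps)
    then show ?thesis
      using nz(1)[of p] by simp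
  qed
  have compat: "differential (G j l) p (axis i 1) =
     (\<Sum>k\<in>UNIV. G l k p * \<Gamma> k i j p) + (\<Sum>k\<in>UNIV. G j k p * \<Gamma> k i l p)" for j l p i
    unfolding G_def \<Gamma>_def by (rule metric_compatible[OF g])
  have om: "\<omega> i p * a1 p = b2 p * \<Gamma> 2 i 1 p" for i p
    by (simp add: \<omega>_def nz)
  have eqs: "G 1 1 = (\<lambda>p. a1 p * a1 p)" "G 1 2 = (\<lambda>p. a1 p * a2 p)" "G 2 2 = (\<lambda>p. a2 p * a2 p + b2 p * b2 p)"
    by (auto simp: G11 G12 G22)
  \<comment> \<open>The Cholesky factor is triangular, so the components 11, 12 and 22 of metric
    compatibility determine the derivatives of \<open>a1\<close>, \<open>a2\<close> and
    \<open>b2\<close> in turn.\<close>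
  have da1: "differential a1 p (axis i 1) = a1 p * \<Gamma> 1 i 1 p + a2 p * \<Gamma> 2 i 1 p" for i p
  proof -
    have "2 * (a1 p * differential a1 p (axis i 1)) = 2 * (a1 p * (a1 p * \<Gamma> 1 i 1 p + a2 p * \<Gamma> 2 i 1 p))"
      using compat[of 1 1 p i] by (simp add: eqs sum_2 differential_mult dt algebra_simps)
    then show ?thesis using nz(1)[of p] by simp
  qed
  have da2: "differential a2 p (axis i 1) = a1 p * \<Gamma> 1 i 2 p + a2 p * \<Gamma> 2 i 2 p + \<omega> i p * b2 p" for i p
  proof -
    have "a1 p * differential a2 p (axis i 1) = a1 p * (a1 p * \<Gamma> 1 i 2 p + a2 p * \<Gamma> 2 i 2 p) + b2 p * (b2 p * \<Gamma> 2 i 1 p)"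
      using compat[of 1 2 p i] by (simp add: eqs Gsym sum_2 differential_mult dt da1 algebra_simps)
    also have "\<dots> = a1 p * (a1 p * \<Gamma> 1 i 2 p + a2 p * \<Gamma> 2 i 2 p + \<omega> i p * b2 p)"
      by (simp add: om[symmetric] algebra_simps)
    finally show ?thesis using nz(1)[of p] by simp
  qed
  have db2: "differential b2 p (axis i 1) = b2 p * \<Gamma> 2 i 2 p - \<omega> i p * a2 p" for i p
  proof -
    have "2 * (b2 p * differential b2 p (axis i 1)) = 2 * (b2 p * (b2 p * \<Gamma> 2 i 2 p - \<omega> i p * a2 p))"
      using compat[of 2 2 p i] by (simp add: eqs Gsym sum_2 differential_mult differential_add
        differentiable_torus_mult dt da2 algebra_simps)
    then show ?thesis using nz(2)[of p] by simp
  qed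
  \<comment> \<open>Flatness enters here. The exterior derivative of \<omega> is, up to sign, the
    Gauss curvature times the area form, and in dimension two the one component
    \<open>riemann_curvature g 2 2 1 1\<close>, which is the curvature times \<open>G 1 1\<close>,
    determines it.\<close>
  have dom: "differential (\<omega> 1) p (axis 2 1) = differential (\<omega> 2) p (axis 1 1)" for p
  proof -
    have e: "(\<lambda>p. \<omega> i p * a1 p) = (\<lambda>p. b2 p * \<Gamma> 2 i 1 p)" for i
      by (rule ext) (rule om)
    have d: "differential (\<omega> i) p (axis m 1) * a1 p = differential b2 p (axis m 1) * \<Gamma> 2 i 1 p
        + b2 p * differential (\<Gamma> 2 i 1) p (axis m 1) - \<omega> i p * differential a1 p (axis m 1)" for i m
      using arg_cong[OF e, of "\<lambda>f. differential f p (axis m 1)" i] by (simp add: differential_mult dt)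
    have "riemann_curvature g 2 2 1 1 p = 0"
      using flat by (simp add: flat_metric_def)
    then have R: "differential (\<Gamma> 2 1 1) p (axis 2 1) = differential (\<Gamma> 2 2 1) p (axis 1 1)
      - (\<Gamma> 2 2 1 p * \<Gamma> 1 1 1 p + \<Gamma> 2 2 2 p * \<Gamma> 2 1 1 p - \<Gamma> 2 1 1 p * \<Gamma> 1 2 1 p - \<Gamma> 2 1 2 p * \<Gamma> 2 2 1 p)"
      by (simp add: riemann_curvature_def \<Gamma>_def sum_2)
    have "(differential (\<omega> 1) p (axis 2 1) - differential (\<omega> 2) p (axis 1 1)) * a1 p
      = (\<omega> 2 p * a1 p) * \<Gamma> 1 1 1 p - (\<omega> 1 p * a1 p) * \<Gamma> 1 2 1 p + b2 p * (\<Gamma> 2 2 2 p * \<Gamma> 2 1 1 p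
        - \<Gamma> 2 1 2 p * \<Gamma> 2 2 1 p + differential (\<Gamma> 2 1 1) p (axis 2 1) - differential (\<Gamma> 2 2 1) p (axis 1 1))"
      unfolding left_diff_distrib d da1 db2 by (simp add: algebra_simps)
    also have "\<dots> = 0"
      unfolding om R by (simp add: algebra_simps)
    finally show ?thesis using nz(1)[of p] by simp
  qed
  define a where "a j = (if j = 1 then a1 else a2)" for j :: 2
  define b where "b j = (if j = 1 then (\<lambda>p. 0) else b2)" for j :: 2
  have ab: "a 1 = a1" "a 2 = a2" "b 1 = (\<lambda>p. 0)" "b 2 = b2"
    by (auto simp: a_def b_def)
  show thesis
  proof (rule that[of a b \<omega>])
    fix j i :: 2 and p
    have ij: "i = 1 \<or> i = 2" "j = 1 \<or> j = 2" by (rule exhaust_2)+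
    show "smooth (a j)" "smooth (b j)" "smooth (\<omega> j)" "b 1 p = 0" "0 < a 1 p" "0 < b 2 p"
      "differential (\<omega> 1) p (axis 2 1) = differential (\<omega> 2) p (axis 1 1)"
      using a1 b2 dom s\<omega> sa1 sa2 sb2 by (simp_all add: a_def b_def)
    show "gram g p $ i $ j = a i p * a j p + b i p * b j p"
      using ij G11[of p] G12[of p] G22[of p] Gsym[of p] by (auto simp: ab G_def)
    show "differential (a j) p (axis i 1) = (\<Sum>k\<in>UNIV. a k p * christoffel g k i j p) + \<omega> i p * b j p"
      using ij(2) unfolding \<Gamma>_def[symmetric] by (auto simp: sum_2 ab da1 da2)
    show "differential (b j) p (axis i 1) = (\<Sum>k\<in>UNIV. b k p * christoffel g k i j p) - \<omega> i p * a j p"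
      using ij(2) unfolding \<Gamma>_def[symmetric] by (auto simp: sum_2 ab db2 om differential_const)
  qed
qed

text \<open>A rotation among the \<open>\<rho>\<close> would have a fixed point \<open>z\<close>, common to all deck transformations since
  they commute. Then \<open>\<parallel>F - z\<parallel>\<close> is periodic, so it attains its maximum, where \<open>F\<close> cannot be a submersion.\<close>

lemma no_rotational_holonomy:
  fixes F :: "real^2 \<Rightarrow> complex"
  assumes F: "\<And>x. (F has_derivative F' x) (at x)" and surj: "\<And>x. surj (F' x)"
    and shift: "\<And>x i. F (x + axis i 1) = \<rho> i * F x + \<beta> i" and norm: "\<And>i. norm (\<rho> i) = 1"
  shows "\<rho> i = 1"
proof (rule ccontr)
  assume i: "\<rho> i \<noteq> 1"
  define z where "z = \<beta> i / (1 - \<rho> i)"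
  have zi: "(1 - \<rho> i) * z = \<beta> i"
    using i by (simp add: z_def)
  have fixed: "\<rho> j * z + \<beta> j = z" for j
  proof -
    have "F ((0 + axis i 1) + axis j 1) = F ((0 + axis j 1) + axis i 1)"
      by (simp add: add.commute)
    then have *: "\<rho> j * \<beta> i + \<beta> j = \<rho> i * \<beta> j + \<beta> i"
      unfolding shift by (simp add: algebra_simps)
    have "(1 - \<rho> i) * (\<rho> j * z + \<beta> j) = \<rho> j * ((1 - \<rho> i) * z) + (1 - \<rho> i) * \<beta> j"
      by (simp add: algebra_simps)
    also have "\<dots> = (1 - \<rho> i) * z"
      unfolding zi using * by (simp add: algebra_simps)
    finally show ?thesis using i by simp
  qed
  define N where "N x = (F x - z) \<bullet> (F x - z)" for x
  have N_norm: "N x = (norm (F x - z))\<^sup>2" for x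
    by (simp add: N_def power2_norm_eq_inner)
  have per: "N (x + axis j 1) = N x" for x j
  proof -
    have "F (x + axis j 1) - z = \<rho> j * (F x - z)"
      using fixed[of j] by (simp add: shift algebra_simps)
    then show ?thesis by (simp add: N_norm norm_mult norm)
  qed
  have dN: "(N has_derivative (\<lambda>v. 2 * ((F x - z) \<bullet> F' x v))) (at x)" for x
    unfolding N_def by (rule has_derivative_eq_rhs, rule has_derivative_inner, (rule has_derivative_diff[OF F has_derivative_const])+)
      (simp add: inner_commute)
  have N_rep: "N (rep_torus (abs_torus x)) = N x" for x
    by (rule periodic_lift[OF per])
  have "continuous_on UNIV N"
    by (rule has_derivative_continuous_on) (rule has_derivative_at_withinI[OF dN])
  then have "continuous_on UNIV (\<lambda>p. N (rep_torus p))"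
    by (simp add: continuous_on_torus_iff N_rep)
  then obtain p where p: "\<And>q. N (rep_torus q) \<le> N (rep_torus p)"
    using continuous_attains_sup[OF compact_torus] by blast
  define x where "x = rep_torus p"
  have max: "N y \<le> N x" for y
    using p[of "abs_torus y"] by (simp add: x_def N_rep)
  then have "(\<lambda>v. 2 * ((F x - z) \<bullet> F' x v)) = (\<lambda>v. 0)"
    by (intro differential_zero_maxmin[OF _ open_UNIV dN]) auto
  \<comment> \<open>The critical point alone gives no contradiction, since \<open>F x = z\<close> is
    possible there. Testing with this \<open>v\<close> shows that it must happen; then the maximum
    of \<open>N\<close> is zero and \<open>F\<close> is constant.\<close>
  moreover obtain v where "F' x v = F x - z"
    using surj[of x] by (metis surjD)
  ultimately have "N x = 0"
    unfolding N_def by (metis mult_eq_0_iff zero_neq_numeral)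
  then have "F y = z" for y
    using max[of y] by (simp add: N_norm)
  then have "F = (\<lambda>y. z)" by auto
  then have "F' x = (\<lambda>v. 0)"
    using has_derivative_unique[OF F[of x]] by simp
  then show False
    using surj[of x] by (metis surjD zero_neq_one)
qed

section \<open>Parallel coframes\<close>

lemma differential_vec2:
  "differentiable_torus f \<Longrightarrow>
    differential f p v = v $ 1 * differential f p (axis 1 1) + v $ 2 * differential f p (axis 2 1)"
  using linear_vec2[OF differential_linear, of f p v] by (simp only: real_scaleR_def)

text \<open>Bootstrapping: the first derivatives of a parallel form are linear in the form with
  smooth coefficients, so each order of differentiability yields the next.\<close>

lemma parallel_smooth:
  fixes u :: "2 \<Rightarrow> torus \<Rightarrow> real"
  assumes "\<And>j. differentiable_torus (u j)"
    and D: "\<And>j p v. differential (u j) p v = (\<Sum>i\<in>UNIV. v $ i * (\<Sum>k\<in>UNIV. u k p * \<Gamma> k i j p))"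
    and \<Gamma>: "\<And>k i j. smooth (\<Gamma> k i j)"
  shows "smooth (u j)"
proof -
  have "\<forall>j. Ck n (u j)" for n
  proof (induction n)
    case 0
    then show ?case using assms(1) by (simp add: continuous_differentiable_torus)
  next
    case (Suc n)
    then show ?case
      using assms(1) \<Gamma> by (auto simp: D sum_2 smooth_def intro!: Ck_add Ck_mult Ck_const)
  qed
  then show ?thesis by (simp add: smooth_def)
qed

text \<open>The pair \<alpha>, \<beta> is the pullback of the two Euclidean coordinate differentials
  under the developing map. The sign of its determinant is recorded so that \<alpha> wedge \<beta>
  is the area density itself and not only up to sign.\<close>

lemma flat_parallel_coframe:
  assumes g: "riemannian_metric g" and flat: "flat_metric g"
  obtains \<alpha> \<beta> where "closed_form \<alpha>" "closed_form \<beta>"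
    "\<And>p v w. g p v w = \<alpha> p v * \<alpha> p w + \<beta> p v * \<beta> p w"
    "\<And>p. 0 < \<alpha> p (axis 1 1) * \<beta> p (axis 2 1) - \<alpha> p (axis 2 1) * \<beta> p (axis 1 1)"
proof -
  define \<Gamma> where "\<Gamma> = christoffel g"
  have s\<Gamma>: "smooth (\<Gamma> k i j)" and \<Gamma>_commute: "\<Gamma> k i j p = \<Gamma> k j i p" for k i j p
    unfolding \<Gamma>_def using christoffel_smooth[OF g] christoffel_commute[OF g] by auto
  obtain a b \<omega> :: "2 \<Rightarrow> torus \<Rightarrow> real" where
    s: "\<And>j. smooth (a j)" "\<And>j. smooth (b j)" "\<And>j. smooth (\<omega> j)"
    and b1: "\<And>p. b 1 p = 0" and a1: "\<And>p. 0 < a 1 p" and b2: "\<And>p. 0 < b 2 p"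
    and G: "\<And>p i j. gram g p $ i $ j = a i p * a j p + b i p * b j p"
    and da: "\<And>p i j. differential (a j) p (axis i 1) = (\<Sum>k\<in>UNIV. a k p * \<Gamma> k i j p) + \<omega> i p * b j p"
    and db: "\<And>p i j. differential (b j) p (axis i 1) = (\<Sum>k\<in>UNIV. b k p * \<Gamma> k i j p) - \<omega> i p * a j p"
    and d\<omega>: "\<And>p. differential (\<omega> 1) p (axis 2 1) = differential (\<omega> 2) p (axis 1 1)"
    unfolding \<Gamma>_def using flat_orthonormal_frame[OF g flat] by blast
  note dt = s[THEN smooth_differentiable]
  have ct: "continuous_on UNIV (\<lambda>x. f (abs_torus x))" if "smooth f" for f
    using smooth_continuous[OF that] by (rule continuous_on_lift)
  have c\<omega>: "continuous_on UNIV (\<lambda>x. differential (\<omega> j) (abs_torus x) v)" for j v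
    by (rule ct[OF smooth_differential[OF s(3)]])
  have c\<Gamma>: "continuous_on UNIV (\<lambda>x. \<Gamma> k i j (abs_torus x))" for k i j
    by (rule ct[OF s\<Gamma>])
  obtain \<theta> where th: "\<And>x. (\<theta> has_derivative (\<lambda>v. \<omega> 1 (abs_torus x) * v $ 1 + \<omega> 2 (abs_torus x) * v $ 2)) (at x)"
    by (rule poincare_plane2[OF has_derivative_lift[OF dt(3)] has_derivative_lift[OF dt(3)]])
      (auto simp: d\<omega> intro: c\<omega>)
  \<comment> \<open>Rotating by a primitive of the connection form cancels the terms in \<omega>, so
    only the Christoffel terms \<open>P\<close> survive in the derivatives: the rotated forms are
    parallel.\<close>
  define u where "u j x = cos (\<theta> x) * a j (abs_torus x) - sin (\<theta> x) * b j (abs_torus x)" for j x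
  define w where "w j x = sin (\<theta> x) * a j (abs_torus x) + cos (\<theta> x) * b j (abs_torus x)" for j x
  define P where "P z j x v = (\<Sum>i\<in>UNIV. v $ i * (\<Sum>k\<in>UNIV. z k x * \<Gamma> k i j (abs_torus x)))"
    for z :: "2 \<Rightarrow> real^2 \<Rightarrow> real" and j x and v :: "real^2"
  have dA: "((\<lambda>x. a j (abs_torus x)) has_derivative (\<lambda>v. P (\<lambda>k x. a k (abs_torus x)) j x v
      + (\<omega> 1 (abs_torus x) * v $ 1 + \<omega> 2 (abs_torus x) * v $ 2) * b j (abs_torus x))) (at x)" for j x
    by (rule has_derivative_eq_rhs[OF has_derivative_lift[OF dt(1)]], rule ext,
        subst differential_vec2[OF dt(1)]) (simp add: da P_def sum_2 algebra_simps)
  have dB: "((\<lambda>x. b j (abs_torus x)) has_derivative (\<lambda>v. P (\<lambda>k x. b k (abs_torus x)) j x v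
      - (\<omega> 1 (abs_torus x) * v $ 1 + \<omega> 2 (abs_torus x) * v $ 2) * a j (abs_torus x))) (at x)" for j x
    by (rule has_derivative_eq_rhs[OF has_derivative_lift[OF dt(2)]], rule ext,
        subst differential_vec2[OF dt(2)]) (simp add: db P_def sum_2 algebra_simps)
  have du: "(u j has_derivative P u j x) (at x)" for j x
    unfolding u_def
    by (rule derivative_eq_intros th dA dB refl)+ (simp add: fun_eq_iff P_def sum_2 algebra_simps)
  have dw: "(w j has_derivative P w j x) (at x)" for j x
    unfolding w_def
    by (rule derivative_eq_intros th dA dB refl)+ (simp add: fun_eq_iff P_def sum_2 algebra_simps)
  have cuw: "continuous_on UNIV (u j)" "continuous_on UNIV (w j)" for j
    using du dw by (blast intro: has_derivative_continuous_on has_derivative_at_withinI)+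
  have cP: "continuous_on UNIV (\<lambda>x. P z j x v)" if "\<And>k. continuous_on UNIV (z k)" for z j v
    unfolding P_def by (intro continuous_intros that c\<Gamma>)
  \<comment> \<open>The connection is torsion free, which makes every parallel form closed and hence
    exact on the plane.\<close>
  have Psym: "P z 1 x (axis 2 1) = P z 2 x (axis 1 1)" for z x
    by (simp add: P_def sum_2 \<Gamma>_commute[of _ 2 1])
  obtain Fu where Fu: "\<And>x. (Fu has_derivative (\<lambda>v. u 1 x * v $ 1 + u 2 x * v $ 2)) (at x)"
    by (rule poincare_plane2[OF du du]) (auto intro: cP cuw Psym)
  obtain Fw where Fw: "\<And>x. (Fw has_derivative (\<lambda>v. w 1 x * v $ 1 + w 2 x * v $ 2)) (at x)"
    by (rule poincare_plane2[OF dw dw]) (auto intro: cP cuw Psym)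
  \<comment> \<open>The developing map, a local isometry from the plane with the lifted metric to
    the complex numbers.\<close>
  define F where "F x = complex_of_real (Fu x) + \<i> * complex_of_real (Fw x)" for x
  define F' where "F' x v = cis (\<theta> x) * Complex (a 1 (abs_torus x) * v $ 1 + a 2 (abs_torus x) * v $ 2) (b 2 (abs_torus x) * v $ 2)"
    for x and v :: "real^2"
  have dF: "(F has_derivative F' x) (at x)" for x
    unfolding F_def
    by (rule derivative_eq_intros Fu Fw refl)+
      (auto simp: fun_eq_iff F'_def u_def w_def b1 complex_eq_iff algebra_simps)
  have "surj (F' x)" for x
  proof (rule surjI)
    fix c :: complex
    define d where "d = cis (- \<theta> x) * c"
    define y where "y = Im d / b 2 (abs_torus x)"
    have "b 2 (abs_torus x) \<noteq> 0" "a 1 (abs_torus x) \<noteq> 0"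
      using a1[of "abs_torus x"] b2[of "abs_torus x"] by auto
    then have "F' x (((Re d - a 2 (abs_torus x) * y) / a 1 (abs_torus x)) *\<^sub>R axis 1 1 + y *\<^sub>R axis 2 1) = cis (\<theta> x) * d"
      by (simp add: F'_def y_def)
    then show "F' x ((\<lambda>c. let d = cis (- \<theta> x) * c; y = Im d / b 2 (abs_torus x) in
        ((Re d - a 2 (abs_torus x) * y) / a 1 (abs_torus x)) *\<^sub>R axis 1 1 + y *\<^sub>R axis 2 1) c) = c"
      by (simp add: Let_def d_def y_def cis_mult flip: mult.assoc)
  qed
  \<comment> \<open>The derivative of \<theta> is periodic although \<theta> need not be. The
    constant is the holonomy angle along the generator, and it makes \<open>F\<close> equivariant up
    to a rotation and a translation.\<close>
  have "\<exists>c. \<forall>x. \<theta> (x + axis i 1) = \<theta> x + c" for i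
  proof -
    have "((\<lambda>x. \<theta> (x + axis i 1)) has_derivative (\<lambda>v. \<omega> 1 (abs_torus x) * v $ 1 + \<omega> 2 (abs_torus x) * v $ 2)) (at x)" for x
      using has_derivative_shift[OF th[of "x + axis i 1"]] by simp
    then obtain c where "\<And>x. \<theta> (x + axis i 1) = \<theta> x + c"
      by (rule constant_difference[OF _ th]) blast
    then show ?thesis by blast
  qed
  then obtain c where c: "\<And>x i. \<theta> (x + axis i 1) = \<theta> x + c i"
    by metis
  have "\<exists>e. \<forall>x. F (x + axis i 1) = cis (c i) * F x + e" for i
  proof -
    have 1: "((\<lambda>x. F (x + axis i 1)) has_derivative (\<lambda>v. cis (c i) * F' x v)) (at x)" for x
      by (rule has_derivative_eq_rhs[OF has_derivative_shift[OF dF]])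
        (simp add: F'_def c fun_eq_iff cis_mult add.commute flip: mult.assoc)
    have 2: "((\<lambda>x. cis (c i) * F x) has_derivative (\<lambda>v. cis (c i) * F' x v)) (at x)" for x
      by (rule has_derivative_mult_right[OF dF])
    obtain e where "\<And>x. F (x + axis i 1) = cis (c i) * F x + e"
      by (rule constant_difference[OF 1 2]) blast
    then show ?thesis by blast
  qed
  then obtain e where "\<And>x i. F (x + axis i 1) = cis (c i) * F x + e i"
    by metis
  then have "cis (c i) = 1" for i
    using no_rotational_holonomy[of F F' "\<lambda>i. cis (c i)" e i] dF \<open>\<And>x. surj (F' x)\<close> by simp
  then have cs: "cos (c i) = 1" "sin (c i) = 0" for i
    by (auto simp: complex_eq_iff)
  \<comment> \<open>The angle \<open>c i\<close> may still be a nonzero multiple of a full turn; the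
    forms depend on \<theta> only through its cosine and sine.\<close>
  have per: "u j (x + axis i 1) = u j x" "w j (x + axis i 1) = w j x" for j x i
    by (simp_all add: u_def w_def c cos_add sin_add cs)
  define U where "U j p = u j (rep_torus p)" for j p
  define W where "W j p = w j (rep_torus p)" for j p
  have U: "U j (abs_torus x) = u j x" and W: "W j (abs_torus x) = w j x" for j x
    unfolding U_def W_def by (rule periodic_lift[OF per(1)], rule periodic_lift[OF per(2)])
  have closed: "closed_form (\<lambda>p v. Z 1 p * v $ 1 + Z 2 p * v $ 2)"
    if lift: "\<And>j x. Z j (abs_torus x) = z j x" and dz: "\<And>j x. (z j has_derivative P z j x) (at x)"
    for Z :: "2 \<Rightarrow> torus \<Rightarrow> real" and z
  proof -
    have dZ: "((\<lambda>x. Z j (abs_torus x)) has_derivative P z j x) (at x)" for j x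
      unfolding lift by (rule dz)
    have dtZ: "differentiable_torus (Z j)" for j
      using dZ by (rule differentiable_torusI)
    have DZ: "differential (Z j) p v = (\<Sum>i\<in>UNIV. v $ i * (\<Sum>k\<in>UNIV. Z k p * \<Gamma> k i j p))" for j p v
      using differential_eqI[OF dZ, of j "rep_torus p"] lift[of _ "rep_torus p"] by (simp add: P_def)
    have sZ: "smooth (Z j)" for j
      by (rule parallel_smooth[OF dtZ DZ s\<Gamma>])
    have "differential (\<lambda>p. Z 1 p * v $ 1 + Z 2 p * v $ 2) p u
        = differential (Z 1) p u * v $ 1 + differential (Z 2) p u * v $ 2" for p u and v :: "real^2"
      by (simp add: differential_add differential_mult differentiable_torus_mult differentiable_torus_const dtZ differential_const)
    then show ?thesis
      by (auto simp: closed_form_def smooth_form_def linear_iff algebra_simps DZ sum_2 \<Gamma>_commute[of _ 2 1]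
          intro!: smooth_intros sZ)
  qed
  have UW: "U j p = cos (\<theta> (rep_torus p)) * a j p - sin (\<theta> (rep_torus p)) * b j p"
    "W j p = sin (\<theta> (rep_torus p)) * a j p + cos (\<theta> (rep_torus p)) * b j p" for j p
    by (simp_all add: U_def W_def u_def w_def)
  show thesis
  proof (rule that[OF closed[OF U du] closed[OF W dw]])
    fix p v z
    define C where "C = cos (\<theta> (rep_torus p))"
    define S where "S = sin (\<theta> (rep_torus p))"
    have CS: "C * C = 1 - S * S"
      using sin_cos_squared_add3[of "\<theta> (rep_torus p)"] unfolding C_def S_def by linarith
    have "U i p * U j p + W i p * W j p = (C * C) * (a i p * a j p + b i p * b j p)
        + (S * S) * (a i p * a j p + b i p * b j p)" for i j
      unfolding UW C_def[symmetric] S_def[symmetric] by (simp add: algebra_simps)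
    then have UG: "U i p * U j p + W i p * W j p = gram g p $ i $ j" for i j
      unfolding CS by (simp add: G algebra_simps)
    show "g p v z = (U 1 p * v $ 1 + U 2 p * v $ 2) * (U 1 p * z $ 1 + U 2 p * z $ 2)
       + (W 1 p * v $ 1 + W 2 p * v $ 2) * (W 1 p * z $ 1 + W 2 p * z $ 2)"
      by (simp add: metric_gram[OF g] UG[symmetric] sum_2 algebra_simps)
    have "U 1 p * W 2 p - U 2 p * W 1 p = (C * C) * (a 1 p * b 2 p) + (S * S) * (a 1 p * b 2 p)"
      unfolding UW C_def[symmetric] S_def[symmetric] by (simp add: algebra_simps b1)
    also have "\<dots> = a 1 p * b 2 p"
      unfolding CS by (simp add: algebra_simps)
    finally show "0 < (U 1 p * axis (1::2) 1 $ 1 + U 2 p * axis (1::2) 1 $ 2) * (W 1 p * axis (2::2) 1 $ 1 + W 2 p * axis (2::2) 1 $ 2)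
       - (U 1 p * axis (2::2) 1 $ 1 + U 2 p * axis (2::2) 1 $ 2) * (W 1 p * axis (1::2) 1 $ 1 + W 2 p * axis (1::2) 1 $ 2)"
      using a1[of p] b2[of p] by simp
  qed
qed

subsection \<open>The invariant measure of the torus\<close>

definition unit_interval :: "real measure" where
  "unit_interval = restrict_space lborel {0..1}"

definition torus_point :: "real \<times> real \<Rightarrow> torus" where
  "torus_point x = abs_torus (fst x *\<^sub>R axis 1 1 + snd x *\<^sub>R axis 2 1)"

text \<open>Opposite edges of the closed unit square are identified by \<open>torus_point\<close>,
  but they carry no mass, so the torus is covered once up to a null set.\<close>

definition haar_torus :: "torus measure" where
  "haar_torus = distr (unit_interval \<Otimes>\<^sub>M unit_interval) borel torus_point"

lemma prob_space_unit_interval: "prob_space unit_interval"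
  by (rule prob_spaceI) (simp add: unit_interval_def emeasure_restrict_space space_restrict_space)

interpretation unit_interval: prob_space unit_interval
  by (rule prob_space_unit_interval)

interpretation unit_square: pair_prob_space unit_interval unit_interval ..

lemma continuous_on_torus_point: "continuous_on S torus_point"
  unfolding torus_point_def
  by (rule continuous_on_compose2[OF continuous_on_abs_torus]) (auto intro!: continuous_intros)

lemma unit_square_borel_measurable: "id \<in> (unit_interval \<Otimes>\<^sub>M unit_interval) \<rightarrow>\<^sub>M (borel :: (real \<times> real) measure)"
proof -
  have "(\<lambda>x. x) \<in> unit_interval \<rightarrow>\<^sub>M borel"
    unfolding unit_interval_def by (rule measurable_restrict_space1) simp
  then have "(\<lambda>x. (fst x, snd x)) \<in> (unit_interval \<Otimes>\<^sub>M unit_interval) \<rightarrow>\<^sub>M (borel \<Otimes>\<^sub>M borel)"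
    by (intro measurable_Pair measurable_compose[OF measurable_fst] measurable_compose[OF measurable_snd])
  then show ?thesis
    by (simp add: borel_prod id_def)
qed

lemma torus_point_measurable: "torus_point \<in> (unit_interval \<Otimes>\<^sub>M unit_interval) \<rightarrow>\<^sub>M borel"
  using measurable_comp[OF unit_square_borel_measurable borel_measurable_continuous_onI[OF continuous_on_torus_point]]
  by simp

lemma prob_space_haar_torus: "prob_space haar_torus"
  unfolding haar_torus_def by (rule unit_square.prob_space_distr[OF torus_point_measurable])

interpretation haar_torus: prob_space haar_torus
  by (rule prob_space_haar_torus)

lemma sets_haar_torus [simp, measurable_cong]: "sets haar_torus = sets borel"
  by (simp add: haar_torus_def)

lemma continuous_measurable_haar_torus: "continuous_on UNIV f \<Longrightarrow> f \<in> haar_torus \<rightarrow>\<^sub>M borel"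
  using borel_measurable_continuous_onI by (simp add: measurable_def space_borel sets_eq_imp_space_eq[OF sets_haar_torus])

lemma integrable_haar_torus:
  fixes f :: "torus \<Rightarrow> 'a::{banach, second_countable_topology}"
  assumes "continuous_on UNIV f"
  shows "integrable haar_torus f"
proof -
  obtain B where "\<And>p. norm (f p) \<le> B"
    using bounded_torus[OF assms] by blast
  then show ?thesis
    by (intro haar_torus.integrable_const_bound[where B=B] continuous_measurable_haar_torus assms) auto
qed

text \<open>The measure has full support: around a representative in the half-open square, a product
  of two intervals has positive mass. This turns equalities of integrals into the pointwise
  conclusions of the rigidity argument.\<close>

lemma haar_torus_continuous_eq_0:
  fixes f :: "torus \<Rightarrow> real"
  assumes f: "continuous_on UNIV f" and nonneg: "\<And>p. 0 \<le> f p" and int: "(LINT p|haar_torus. f p) = 0"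
  shows "f p = 0"
proof (rule ccontr)
  assume "f p \<noteq> 0"
  obtain y where y: "abs_torus y = p" "\<And>i. 0 \<le> y $ i" "\<And>i. y $ i < 1"
    using lattice_representative[of p] by blast
  define h where "h x = f (torus_point x)" for x
  have "continuous_on UNIV h"
    unfolding h_def by (rule continuous_on_compose2[OF f continuous_on_torus_point]) auto
  then have "open {x. h x \<noteq> 0}"
    by (intro open_Collect_neq continuous_intros)
  moreover have "torus_point (y $ 1, y $ 2) = p"
    using y(1) vec2_eq[of y] by (simp add: torus_point_def)
  then have "(y $ 1, y $ 2) \<in> {x. h x \<noteq> 0}"
    using \<open>f p \<noteq> 0\<close> by (simp add: h_def)
  ultimately obtain A B where AB: "open A" "open B" "y $ 1 \<in> A" "y $ 2 \<in> B" "A \<times> B \<subseteq> {x. h x \<noteq> 0}"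
    by (auto elim: open_prod_elim)
  have pos: "\<exists>U\<in>sets unit_interval. U \<subseteq> A \<and> emeasure unit_interval U > 0"
    if A: "open A" "z \<in> A" and z: "0 \<le> z" "z < 1" for A z
  proof -
    obtain e where e: "e > 0" "ball z e \<subseteq> A"
      using A open_contains_ball by blast
    define r where "r = min (z + e) 1"
    have "z < r" "{z<..<r} \<subseteq> A" "{z<..<r} \<subseteq> {0..1}"
      using e z by (auto simp: r_def ball_def dist_real_def subset_eq)
    then show ?thesis
      by (intro bexI[of _ "{z<..<r}"])
        (auto simp: unit_interval_def emeasure_restrict_space sets_restrict_space_iff)
  qed
  obtain U V where UV: "U \<in> sets unit_interval" "U \<subseteq> A" "emeasure unit_interval U > 0"
    "V \<in> sets unit_interval" "V \<subseteq> B" "emeasure unit_interval V > 0"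
    using pos AB y by metis
  have "AE p in haar_torus. f p = 0"
    using integral_nonneg_eq_0_iff_AE[OF integrable_haar_torus[OF f]] nonneg int by auto
  then have "AE x in unit_interval \<Otimes>\<^sub>M unit_interval. h x = 0"
    unfolding haar_torus_def h_def
    using AE_distr_iff[OF torus_point_measurable, of "\<lambda>p. f p = 0"] borel_measurable_continuous_onI[OF f] by auto
  then have "AE x in unit_interval \<Otimes>\<^sub>M unit_interval. x \<notin> U \<times> V"
    using AB UV by (auto elim!: eventually_mono)
  then have "emeasure (unit_interval \<Otimes>\<^sub>M unit_interval) (U \<times> V) = 0"
    using AE_iff_null_sets[of "U \<times> V" "unit_interval \<Otimes>\<^sub>M unit_interval"] UV by auto
  then show False
    using UV by (auto simp: unit_interval.emeasure_pair_measure_Times)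
qed

lemma integral_unit_interval_derivative:
  fixes f :: "real \<Rightarrow> real"
  assumes "\<And>t. (f has_field_derivative f' t) (at t)" and "continuous_on UNIV f'"
  shows "(LINT t|unit_interval. f' t) = f 1 - f 0"
proof -
  have "(LINT t|unit_interval. f' t) = (LINT t|lborel. f' t * indicator {0..1} t)"
    by (simp add: unit_interval_def integral_restrict_space mult.commute)
  also have "\<dots> = f 1 - f 0"
    using assms by (intro integral_FTC_Icc_real) (auto simp: continuous_on_eq_continuous_at)
  finally show ?thesis .
qed

text \<open>By Fubini one integrates first along the loops in direction \<open>i\<close>, where the
  fundamental theorem gives the difference of the values at two endpoints that coincide on the
  torus.\<close>

lemma integral_haar_torus_differential:
  assumes "Ck 1 f"
  shows "(LINT p|haar_torus. differential f p (axis i 1)) = 0"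
proof -
  define D where "D p = differential f p (axis i 1)" for p
  have dt: "differentiable_torus f" and c: "continuous_on UNIV D"
    using assms by (auto simp: D_def)
  have int: "integrable (unit_interval \<Otimes>\<^sub>M unit_interval) (\<lambda>(s, t). D (torus_point (s, t)))"
    using integrable_haar_torus[OF c] integrable_distr_eq[OF torus_point_measurable borel_measurable_continuous_onI[OF c]]
    by (simp add: haar_torus_def case_prod_unfold)
  have line: "(LINT t|unit_interval. D (abs_torus (x + t *\<^sub>R axis i 1))) = 0" for x
  proof -
    have "((\<lambda>t. f (abs_torus (x + t *\<^sub>R axis i 1))) has_field_derivative D (abs_torus (x + t *\<^sub>R axis i 1))) (at t)" for t
    proof -
      have "((\<lambda>t. f (abs_torus (x + t *\<^sub>R axis i 1))) has_derivative
          (\<lambda>s. differential f (abs_torus (x + t *\<^sub>R axis i 1)) (s *\<^sub>R axis i 1))) (at t)"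
        by (rule has_derivative_compose[OF _ has_derivative_lift[OF dt]]) (auto intro!: derivative_eq_intros)
      then show ?thesis
        unfolding linear_cmul[OF differential_linear[OF dt]] has_field_derivative_def D_def
        by (rule has_derivative_eq_rhs) (simp add: fun_eq_iff mult.commute)
    qed
    moreover have "continuous_on UNIV (\<lambda>t. D (abs_torus (x + t *\<^sub>R axis i 1)))"
      by (rule continuous_on_compose2[OF continuous_on_lift[OF c]]) (auto intro!: continuous_intros)
    ultimately show ?thesis
      using integral_unit_interval_derivative by fastforce
  qed
  have "(LINT p|haar_torus. D p) = integral\<^sup>L (unit_interval \<Otimes>\<^sub>M unit_interval) (\<lambda>(s, t). D (torus_point (s, t)))"
    by (simp add: haar_torus_def integral_distr[OF torus_point_measurable borel_measurable_continuous_onI[OF c]] case_prod_unfold)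
  also have "\<dots> = 0"
  proof (cases "i = 1")
    case True
    then show ?thesis
      using line[of "t *\<^sub>R axis 2 1" for t] unit_square.integral_snd[OF int]
      by (simp add: torus_point_def add.commute)
  next
    case False
    then have "i = 2" using exhaust_2[of i] by auto
    then show ?thesis
      using line[of "s *\<^sub>R axis 1 1" for s] unit_square.integral_fst'[OF int]
      by (simp add: torus_point_def)
  qed
  finally show ?thesis by (simp add: D_def)
qed

subsection \<open>Closed measures\<close>

lemma continuous_on_form:
  fixes \<eta> :: one_form
  assumes "\<And>p. linear (\<eta> p)" "\<And>v. continuous_on UNIV (\<lambda>p. \<eta> p v)"
  shows "continuous_on UNIV (\<lambda>(p, v). \<eta> p v :: real)"
proof -
  have "continuous_on UNIV (\<lambda>x. snd x $ 1 * \<eta> (fst x) (axis 1 1) + snd x $ 2 * \<eta> (fst x) (axis 2 1))"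
    by (intro continuous_intros continuous_on_compose2[OF assms(2) continuous_on_fst]) auto
  moreover have "(\<lambda>(p, v). \<eta> p v) = (\<lambda>x. snd x $ 1 * \<eta> (fst x) (axis 1 1) + snd x $ 2 * \<eta> (fst x) (axis 2 1))"
    by (rule ext, clarsimp, subst linear_vec2[OF assms(1)]) simp
  ultimately show ?thesis by simp
qed

lemma closed_formD:
  assumes "closed_form \<eta>"
  shows "linear (\<eta> p)" "smooth (\<lambda>p. \<eta> p v)" "continuous_on UNIV (\<lambda>p. \<eta> p v)"
    "differential (\<lambda>q. \<eta> q w) p v = differential (\<lambda>q. \<eta> q v) p w"
  using assms by (auto simp: closed_form_def smooth_form_def smooth_continuous)

lemma continuous_measurable_tangent:
  assumes "sets \<mu> = sets (borel :: tangent measure)" "continuous_on UNIV f"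
  shows "f \<in> \<mu> \<rightarrow>\<^sub>M borel"
  using borel_measurable_continuous_onI[OF assms(2)] measurable_cong_sets[OF assms(1) refl] by blast

context
  fixes \<mu> :: "tangent measure"
  assumes \<mu>: "\<mu> \<in> closed_measures"
begin

lemma closed_measure_sets: "sets \<mu> = sets borel"
  and closed_measure_prob: "prob_space \<mu>"
  and closed_measure_moment: "integrable \<mu> (\<lambda>(p, v). norm v)"
  and closed_measure_exact: "Ck 1 f \<Longrightarrow> (LINT (p, v)|\<mu>. differential f p v) = 0"
  using \<mu> by (auto simp: closed_measures_def)

lemma closed_measure_form_integrable:
  fixes \<eta> :: one_form
  assumes lin: "\<And>p. linear (\<eta> p)" and cont: "\<And>v. continuous_on UNIV (\<lambda>p. \<eta> p v)"
  shows "integrable \<mu> (\<lambda>(p, v). \<eta> p v)"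
proof -
  obtain B1 B2 where B: "\<And>p. norm (\<eta> p (axis 1 1)) \<le> B1" "\<And>p. norm (\<eta> p (axis 2 1)) \<le> B2"
    using bounded_torus[OF cont] by metis
  have bound: "\<bar>\<eta> p v\<bar> \<le> (B1 + B2) * norm v" for p v
  proof -
    have "\<bar>\<eta> p v\<bar> \<le> \<bar>v $ 1\<bar> * \<bar>\<eta> p (axis 1 1)\<bar> + \<bar>v $ 2\<bar> * \<bar>\<eta> p (axis 2 1)\<bar>"
      by (subst linear_vec2[OF lin]) (simp flip: abs_mult add: abs_triangle_ineq)
    also have "\<dots> \<le> norm v * B1 + norm v * B2"
      using B(1)[of p] B(2)[of p] by (intro add_mono mult_mono component_le_norm_cart) auto
    finally show ?thesis by (simp add: algebra_simps)
  qed
  have "integrable \<mu> (\<lambda>x. (B1 + B2) * norm (snd x))"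
    using closed_measure_moment by (simp add: case_prod_unfold)
  then show ?thesis
  proof (rule Bochner_Integration.integrable_bound)
    show "(\<lambda>(p, v). \<eta> p v) \<in> borel_measurable \<mu>"
      by (intro continuous_measurable_tangent[OF closed_measure_sets] continuous_on_form assms)
    show "AE x in \<mu>. norm (case x of (p, v) \<Rightarrow> \<eta> p v) \<le> norm ((B1 + B2) * norm (snd x))"
    proof (rule AE_I2)
      fix x :: tangent
      show "norm (case x of (p, v) \<Rightarrow> \<eta> p v) \<le> norm ((B1 + B2) * norm (snd x))"
        using order_trans[OF bound abs_ge_self, of "fst x" "snd x"] by (simp only: case_prod_unfold real_norm_def)
    qed
  qed
qed

lemma closed_measure_velocity_integrable: "integrable \<mu> snd"
  using closed_measure_moment
  by (intro integrable_norm_cancel[of \<mu> snd] continuous_measurable_tangent[OF closed_measure_sets] continuous_on_snd)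
    (auto simp: case_prod_unfold)

text \<open>The exact part of a closed form integrates to zero by closedness of the measure, and the
  constant-coefficient part is linear in the velocity.\<close>

lemma rotation_vector_eq: "rotation_vector \<mu> = (LINT x|\<mu>. snd x)" (is "_ = ?h")
  and pairing_rotation_vector:
    "closed_form \<eta> \<Longrightarrow> pairing \<eta> (rotation_vector \<mu>) = (LINT (p, v)|\<mu>. \<eta> p v)"
proof -
  have h: "pairing \<eta> ?h = (LINT (p, v)|\<mu>. \<eta> p v)" if \<eta>: "closed_form \<eta>" for \<eta>
  proof -
    obtain f where f: "Ck 1 f" "\<And>p v. \<eta> p v = differential f p v + pairing \<eta> v"
      using closed_form_exact[OF \<eta>] by blast
    have bl: "bounded_linear (pairing \<eta>)"
      by (rule linear_conv_bounded_linear[THEN iffD1, OF linear_pairing])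
    have int: "integrable \<mu> (\<lambda>x. differential f (fst x) (snd x))"
      using closed_measure_form_integrable[of "differential f"] f(1)
      by (auto simp: case_prod_unfold differential_linear)
    have "(LINT (p, v)|\<mu>. \<eta> p v) = (LINT x|\<mu>. differential f (fst x) (snd x) + pairing \<eta> (snd x))"
      by (simp add: f(2) case_prod_unfold)
    also have "\<dots> = (LINT x|\<mu>. differential f (fst x) (snd x)) + (LINT x|\<mu>. pairing \<eta> (snd x))"
      using int integrable_bounded_linear[OF bl closed_measure_velocity_integrable] by simp
    also have "\<dots> = pairing \<eta> ?h"
      using closed_measure_exact[OF f(1)] integral_bounded_linear[OF bl closed_measure_velocity_integrable]
      by (simp add: case_prod_unfold)
    finally show ?thesis by simp
  qed
  show eq: "rotation_vector \<mu> = ?h"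
    unfolding rotation_vector_def
  proof (rule the_equality)
    show "\<forall>\<eta>. closed_form \<eta> \<longrightarrow> pairing \<eta> ?h = (LINT (p, v)|\<mu>. \<eta> p v)"
      using h by blast
    fix k
    assume k: "\<forall>\<eta>. closed_form \<eta> \<longrightarrow> pairing \<eta> k = (LINT (p, v)|\<mu>. \<eta> p v)"
    have "k $ i = ?h $ i" for i
    proof -
      \<comment> \<open>The coordinate forms read off the components of a class, which gives the
        uniqueness that \<open>THE\<close> requires.\<close>
      have c: "closed_form (\<lambda>p v. v $ i)"
        by (auto simp: closed_form_def smooth_form_def differential_const linear_iff)
      have "pairing (\<lambda>p v. v $ i) z = z $ i" for z
        using exhaust_2[of i] by (auto simp: pairing_def sum_2)
      then show ?thesis using h[OF c] k c by metis
    qed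
    then show "k = ?h" by (simp add: vec_eq_iff)
  qed
  show "pairing \<eta> (rotation_vector \<mu>) = (LINT (p, v)|\<mu>. \<eta> p v)" if "closed_form \<eta>" for \<eta>
    using h[OF that] eq by simp
qed

end

subsection \<open>Measures carried by vector fields\<close>

definition vol :: "metric \<Rightarrow> torus \<Rightarrow> real" where
  "vol g p = sqrt (det (gram g p))"

definition area :: "metric \<Rightarrow> real" where
  "area g = (LINT p|haar_torus. vol g p)"

definition field_measure :: "metric \<Rightarrow> (torus \<Rightarrow> real^2) \<Rightarrow> tangent measure" where
  "field_measure g X = distr (density haar_torus (\<lambda>p. ennreal (vol g p / area g))) borel (\<lambda>p. (p, X p))"

context
  fixes g :: metric
  assumes g: "riemannian_metric g"
begin

lemma vol_pos: "0 < vol g p"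
  by (simp add: vol_def det_gram_pos[OF g])

lemma vol_continuous: "continuous_on UNIV (vol g)"
  unfolding vol_def by (intro continuous_intros smooth_continuous det_gram_smooth[OF g])

lemma area_pos: "0 < area g"
proof -
  have "0 \<le> area g"
    unfolding area_def by (rule integral_nonneg_AE) (simp add: vol_pos less_imp_le)
  moreover have "area g \<noteq> 0"
    using haar_torus_continuous_eq_0[OF vol_continuous] vol_pos less_imp_le less_irrefl
    unfolding area_def by metis
  ultimately show ?thesis by simp
qed

context
  fixes X :: "torus \<Rightarrow> real^2"
  assumes X: "continuous_on UNIV X"
begin

lemma field_measure_integral:
  fixes k :: "tangent \<Rightarrow> 'a::{banach, second_countable_topology}"
  assumes k: "continuous_on UNIV k"
  shows "(LINT x|field_measure g X. k x) = (LINT p|haar_torus. (vol g p / area g) *\<^sub>R k (p, X p))"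
    and "integrable (field_measure g X) k"
proof -
  have kX: "continuous_on UNIV (\<lambda>p. k (p, X p))"
    by (rule continuous_on_compose2[OF k]) (auto intro!: continuous_intros X)
  have m: "(\<lambda>p. (p, X p)) \<in> density haar_torus (\<lambda>p. ennreal (vol g p / area g)) \<rightarrow>\<^sub>M borel"
    by (simp, intro continuous_measurable_haar_torus continuous_intros X)
  have v: "(\<lambda>p. vol g p / area g) \<in> borel_measurable haar_torus"
    using area_pos by (intro continuous_measurable_haar_torus continuous_intros vol_continuous) auto
  have pos: "AE p in haar_torus. 0 \<le> vol g p / area g"
    using vol_pos area_pos by (simp add: less_imp_le)
  have km: "k \<in> borel_measurable borel"
    by (rule borel_measurable_continuous_onI[OF k])
  note kXm = continuous_measurable_haar_torus[OF kX]
  show "(LINT x|field_measure g X. k x) = (LINT p|haar_torus. (vol g p / area g) *\<^sub>R k (p, X p))"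
    unfolding field_measure_def integral_distr[OF m km] by (rule integral_density[OF kXm v pos])
  show "integrable (field_measure g X) k"
    unfolding field_measure_def integrable_distr_eq[OF m km] integrable_density[OF kXm v pos]
    using area_pos by (intro integrable_haar_torus continuous_intros vol_continuous kX) auto
qed

lemma field_measure_sets: "sets (field_measure g X) = sets borel"
  by (simp add: field_measure_def)

lemma field_measure_prob: "prob_space (field_measure g X)"
proof -
  have m: "(\<lambda>p. (p, X p)) \<in> density haar_torus (\<lambda>p. ennreal (vol g p / area g)) \<rightarrow>\<^sub>M borel"
    by (simp, intro continuous_measurable_haar_torus continuous_intros X)
  have c: "continuous_on UNIV (\<lambda>p. vol g p / area g)"
    using area_pos by (intro continuous_intros vol_continuous) auto
  have "prob_space (density haar_torus (\<lambda>p. ennreal (vol g p / area g)))"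
  proof (rule prob_spaceI)
    have space: "space haar_torus = UNIV"
      using sets_eq_imp_space_eq[OF sets_haar_torus] by simp
    have "emeasure (density haar_torus (\<lambda>p. ennreal (vol g p / area g))) (space haar_torus)
        = (\<integral>\<^sup>+ p. ennreal (vol g p / area g) \<partial>haar_torus)"
      using continuous_measurable_haar_torus[OF c]
      by (subst emeasure_density) (auto simp: space)
    also have "\<dots> = ennreal (LINT p|haar_torus. vol g p / area g)"
      using vol_pos area_pos by (intro nn_integral_eq_integral integrable_haar_torus c) (simp add: less_imp_le)
    also have "\<dots> = 1"
      using area_pos by (simp add: area_def)
    finally show "emeasure (density haar_torus (\<lambda>p. ennreal (vol g p / area g)))
        (space (density haar_torus (\<lambda>p. ennreal (vol g p / area g)))) = 1" by simp
  qed
  then show ?thesis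
    unfolding field_measure_def by (rule prob_space.prob_space_distr[OF _ m])
qed

text \<open>The hypothesis is the weak form of the vanishing of the divergence of \<open>X\<close>
  with respect to the area of \<open>g\<close>.\<close>

lemma field_measure_closed:
  assumes "\<And>f. Ck 1 f \<Longrightarrow> (LINT p|haar_torus. vol g p * differential f p (X p)) = 0"
  shows "field_measure g X \<in> closed_measures"
proof -
  have "(LINT (p, v)|field_measure g X. differential f p v) = 0" if f: "Ck 1 f" for f
  proof -
    have c: "continuous_on UNIV (\<lambda>(p, v). differential f p v)"
      using f by (intro continuous_on_form) (auto intro: differential_linear)
    show ?thesis
      using assms[OF f] by (simp add: field_measure_integral(1)[OF c])
  qed
  moreover have "integrable (field_measure g X) (\<lambda>(p, v). norm v)"
    by (intro field_measure_integral) (auto intro!: continuous_intros simp: case_prod_unfold)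
  ultimately show ?thesis
    by (simp add: closed_measures_def field_measure_sets field_measure_prob)
qed

end
end

subsection \<open>Parallel vector fields of a flat metric\<close>

lemma closed_form_combination:
  assumes "closed_form \<alpha>" "closed_form \<beta>"
  shows "closed_form (\<lambda>p v. a * \<alpha> p v + b * \<beta> p v)"
proof -
  note A = closed_formD[OF assms(1)] and B = closed_formD[OF assms(2)]
  have "differential (\<lambda>q. a * \<alpha> q w + b * \<beta> q w) p v
      = a * differential (\<lambda>q. \<alpha> q w) p v + b * differential (\<lambda>q. \<beta> q w) p v" for p v w
    using A(2) B(2) by (simp add: differential_add differential_mult differentiable_torus_mult
        differentiable_torus_const differential_const smooth_differentiable)
  moreover have "differential (\<lambda>q. a * \<alpha> q w + b * \<beta> q w) p v = differential (\<lambda>q. a * \<alpha> q v + b * \<beta> q v) p w" for p v w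
    unfolding calculation A(4)[of w p v] B(4)[of w p v] ..
  ultimately show ?thesis
    using A(1) B(1) by (auto simp: closed_form_def smooth_form_def linear_iff algebra_simps intro!: smooth_intros A(2) B(2))
qed

text \<open>Stokes: since \<eta> is closed, \<open>df\<close> wedge \<eta> is the exterior
  derivative of \<open>f \<eta>\<close>.\<close>

lemma integral_wedge_exact_closed:
  assumes f: "Ck 1 f" and \<eta>: "closed_form \<eta>"
  shows "(LINT p|haar_torus. differential f p (axis 1 1) * \<eta> p (axis 2 1)
    - differential f p (axis 2 1) * \<eta> p (axis 1 1)) = 0"
proof -
  have s: "smooth (\<lambda>p. \<eta> p v)" for v
    by (rule closed_formD[OF \<eta>])
  have dt: "differentiable_torus f" "differentiable_torus (\<lambda>p. \<eta> p v)" for v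
    using f smooth_differentiable[OF s] by auto
  have "Ck 1 (\<lambda>p. f p * \<eta> p v)" for v
    using s by (intro Ck_mult f) (simp add: smooth_def)
  then have 0: "(LINT p|haar_torus. differential (\<lambda>p. f p * \<eta> p v) p (axis i 1)) = 0"
    and c: "continuous_on UNIV (\<lambda>p. differential (\<lambda>p. f p * \<eta> p v) p (axis i 1))" for v i
    using integral_haar_torus_differential by auto
  have "differential f p (axis 1 1) * \<eta> p (axis 2 1) - differential f p (axis 2 1) * \<eta> p (axis 1 1)
      = differential (\<lambda>p. f p * \<eta> p (axis 2 1)) p (axis 1 1) - differential (\<lambda>p. f p * \<eta> p (axis 1 1)) p (axis 2 1)" for p
    using closed_formD(4)[OF \<eta>, of "axis 2 1" p "axis 1 1"] by (simp add: differential_mult dt)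
  then show ?thesis
    using 0 Bochner_Integration.integral_diff[OF integrable_haar_torus[OF c] integrable_haar_torus[OF c]] by simp
qed

text \<open>The parallel fields are those on which \<alpha> and \<beta> take constant values, so
  they form a plane of parameters \<open>c\<close>. The rotation vector is an injective linear
  function of \<open>c\<close>, so every class is reached.\<close>

lemma flat_parallel_field:
  assumes g: "riemannian_metric g" and flat: "flat_metric g"
  obtains X \<kappa> where "continuous_on UNIV X" "closed_form (\<lambda>p. g p (X p))" "\<And>p. g p (X p) (X p) = \<kappa>"
    "field_measure g X \<in> closed_measures" "rotation_vector (field_measure g X) = h"
proof -
  obtain \<alpha> \<beta> where \<alpha>: "closed_form \<alpha>" and \<beta>: "closed_form \<beta>"
    and g_eq: "\<And>p v w. g p v w = \<alpha> p v * \<alpha> p w + \<beta> p v * \<beta> p w"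
    and pos: "\<And>p. 0 < \<alpha> p (axis 1 1) * \<beta> p (axis 2 1) - \<alpha> p (axis 2 1) * \<beta> p (axis 1 1)"
    using flat_parallel_coframe[OF g flat] by blast
  note A = closed_formD[OF \<alpha>] and B = closed_formD[OF \<beta>]
  define d where "d p = \<alpha> p (axis 1 1) * \<beta> p (axis 2 1) - \<alpha> p (axis 2 1) * \<beta> p (axis 1 1)" for p
  have d0: "0 < d p" for p unfolding d_def by (rule pos)
  then have dnz: "d p \<noteq> 0" for p by (metis less_irrefl)
  have vol: "vol g p = d p" for p
  proof -
    have "det (gram g p) = (d p)\<^sup>2"
      by (simp add: det_2 gram_def g_eq d_def power2_eq_square algebra_simps)
    then show ?thesis using d0[of p] by (simp add: vol_def)
  qed
  \<comment> \<open>Cramer's rule for \<open>\<alpha> p (X c p) = c $ 1\<close> and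
    \<open>\<beta> p (X c p) = c $ 2\<close>, before division by the determinant \<open>d\<close>.
    As \<open>d\<close> is also the weight \<open>vol g\<close>, integrals over the field measure
    involve only \<open>Y\<close>.\<close>
  define Y where "Y c p = (\<beta> p (axis 2 1) * c $ 1 - \<alpha> p (axis 2 1) * c $ 2) *\<^sub>R axis 1 1
    + (\<alpha> p (axis 1 1) * c $ 2 - \<beta> p (axis 1 1) * c $ 1) *\<^sub>R axis (2::2) (1::real)" for c :: "real^2" and p
  define X where "X c p = (1 / d p) *\<^sub>R Y c p" for c p
  have dX: "d p *\<^sub>R X c p = Y c p" for c p
    using d0[of p] by (simp add: X_def)
  have cY: "continuous_on UNIV (Y c)" for c
    unfolding Y_def by (intro continuous_intros A(3) B(3))
  have cX: "continuous_on UNIV (X c)" for c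
    unfolding X_def d_def using pos by (intro continuous_intros A(3) B(3) cY) (metis less_irrefl)
  have "d p * \<alpha> p (X c p) = d p * c $ 1" "d p * \<beta> p (X c p) = d p * c $ 2" for c p
  proof -
    have "d p * \<alpha> p (X c p) = \<alpha> p (Y c p)"
      using linear_cmul[OF A(1), of p "d p" "X c p"] by (simp add: dX)
    also have "\<dots> = d p * c $ 1"
      by (subst linear_vec2[OF A(1)]) (simp add: Y_def d_def algebra_simps)
    finally show "d p * \<alpha> p (X c p) = d p * c $ 1" .
    have "d p * \<beta> p (X c p) = \<beta> p (Y c p)"
      using linear_cmul[OF B(1), of p "d p" "X c p"] by (simp add: dX)
    also have "\<dots> = d p * c $ 2"
      by (subst linear_vec2[OF B(1)]) (simp add: Y_def d_def algebra_simps)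
    finally show "d p * \<beta> p (X c p) = d p * c $ 2" .
  qed
  then have \<alpha>X: "\<alpha> p (X c p) = c $ 1" and \<beta>X: "\<beta> p (X c p) = c $ 2" for c p
    by (simp_all add: dnz)
  have gX: "g p (X c p) = (\<lambda>v. c $ 1 * \<alpha> p v + c $ 2 * \<beta> p v)" for c p
    by (simp add: g_eq \<alpha>X \<beta>X fun_eq_iff)
  have cl: "closed_form (\<lambda>p. g p (X c p))" for c
    unfolding gX by (rule closed_form_combination[OF \<alpha> \<beta>])
  have gXX: "g p (X c p) (X c p) = c \<bullet> c" for c p
    by (simp add: gX \<alpha>X \<beta>X inner_vec_def sum_2)
  have closed: "field_measure g (X c) \<in> closed_measures" for c
  proof (rule field_measure_closed[OF g cX])
    fix f assume f: "Ck 1 f"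
    then have lin: "linear (differential f p)" for p
      by (simp add: differential_linear)
    have cf: "continuous_on UNIV (\<lambda>p. differential f p v)" for v
      using f by simp
    \<comment> \<open>Contracting the area form \<alpha> wedge \<beta> with \<open>X c\<close> gives
      the closed form \<open>c $ 1 \<beta> - c $ 2 \<alpha>\<close>; the right-hand side is
      \<open>df\<close> wedge this form.\<close>
    have "vol g p * differential f p (X c p) =
        c $ 1 * (differential f p (axis 1 1) * \<beta> p (axis 2 1) - differential f p (axis 2 1) * \<beta> p (axis 1 1))
      - c $ 2 * (differential f p (axis 1 1) * \<alpha> p (axis 2 1) - differential f p (axis 2 1) * \<alpha> p (axis 1 1))" for p
    proof -
      have "vol g p * differential f p (X c p) = differential f p (Y c p)"
        using linear_cmul[OF lin, of p "d p" "X c p"] by (simp add: dX vol)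
      then show ?thesis
        by (simp only: linear_vec2[OF lin, of p "Y c p"]) (simp add: Y_def algebra_simps)
    qed
    then have "(LINT p|haar_torus. vol g p * differential f p (X c p)) =
        (LINT p|haar_torus. c $ 1 * (differential f p (axis 1 1) * \<beta> p (axis 2 1) - differential f p (axis 2 1) * \<beta> p (axis 1 1)))
      - (LINT p|haar_torus. c $ 2 * (differential f p (axis 1 1) * \<alpha> p (axis 2 1) - differential f p (axis 2 1) * \<alpha> p (axis 1 1)))"
      by (simp only:) (intro Bochner_Integration.integral_diff integrable_haar_torus continuous_intros cf A(3) B(3))
    also have "\<dots> = 0"
      by (simp only: integral_mult_right_zero integral_wedge_exact_closed[OF f \<alpha>] integral_wedge_exact_closed[OF f \<beta>])
    finally show "(LINT p|haar_torus. vol g p * differential f p (X c p)) = 0" .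
  qed
  define R where "R c = rotation_vector (field_measure g (X c))" for c
  have R: "R c = (LINT p|haar_torus. (1 / area g) *\<^sub>R Y c p)" for c
    unfolding R_def rotation_vector_eq[OF closed]
    by (subst field_measure_integral(1)[OF g cX continuous_on_snd[OF continuous_on_id]])
      (simp add: vol dX[symmetric] divide_inverse mult.commute)
  have "linear R"
  proof (rule linearI)
    have Y: "Y (a + b) p = Y a p + Y b p" "Y (r *\<^sub>R a) p = r *\<^sub>R Y a p" for a b r p
      by (simp_all add: Y_def vec_eq_iff forall_2 algebra_simps)
    show "R (a + b) = R a + R b" for a b
      unfolding R Y scaleR_add_right by (intro Bochner_Integration.integral_add integrable_haar_torus continuous_intros cY)
    show "R (r *\<^sub>R a) = r *\<^sub>R R a" for r a
      unfolding R Y by (subst integral_scaleR_right[symmetric]) (simp add: integrable_haar_torus cY continuous_intros mult.commute)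
  qed
  \<comment> \<open>Pairing \<open>R c\<close> with the closed form dual to \<open>X c\<close>
    returns \<open>c \<bullet> c\<close>, so the kernel of \<open>R\<close> is trivial.\<close>
  moreover have "c = 0" if "R c = 0" for c
  proof -
    have "continuous_on UNIV (\<lambda>(p, v). g p (X c p) v)"
      by (intro continuous_on_form closed_formD[OF cl])
    then have "(LINT (p, v)|field_measure g (X c). g p (X c p) v) = (LINT p|haar_torus. vol g p * ((c \<bullet> c) / area g))"
      by (simp add: field_measure_integral(1)[OF g cX] gXX)
    also have "\<dots> = c \<bullet> c"
      using area_pos[OF g] by (simp only: integral_mult_left_zero area_def[symmetric]) simp
    finally have "c \<bullet> c = pairing (\<lambda>p. g p (X c p)) (R c)"
      unfolding R_def by (simp add: pairing_rotation_vector[OF closed cl])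
    then show ?thesis using that by (simp add: linear_0[OF linear_pairing])
  qed
  ultimately have "surj R"
    by (intro linear_injective_imp_surjective) (auto simp: linear_injective_0)
  then obtain c where "R c = h" by (metis surjD)
  then show thesis
    using that[OF cX cl gXX closed] by (simp add: R_def)
qed

subsection \<open>Calibration and the beta function\<close>

lemma lagrangian_eq: "riemannian_metric g \<Longrightarrow> lagrangian g p v = g p v v / 2"
  by (simp add: lagrangian_def metric_norm_def metric_nonneg)

lemma continuous_on_metric:
  assumes g: "riemannian_metric g"
    and v: "continuous_on UNIV v" and w: "continuous_on UNIV w" and q: "continuous_on UNIV q"
  shows "continuous_on UNIV (\<lambda>x. g (q x) (v x) (w x))"
proof -
  have gq: "continuous_on UNIV (\<lambda>x. gram g (q x) $ i $ j)" for i j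
    by (rule continuous_on_compose2[OF smooth_continuous[OF gram_smooth[OF g]] q]) auto
  have vw: "continuous_on UNIV (\<lambda>x. v x $ i)" "continuous_on UNIV (\<lambda>x. w x $ i)" for i
    by (intro continuous_intros v w)+
  show ?thesis
    by (subst metric_gram[OF g], unfold sum_2) (rule continuous_on_add continuous_on_mult gq vw)+
qed

lemma continuous_on_lagrangian:
  assumes "riemannian_metric g"
  shows "continuous_on UNIV (\<lambda>(p, v). lagrangian g p v)"
  by (auto simp: lagrangian_eq[OF assms] case_prod_unfold intro!: continuous_intros continuous_on_metric[OF assms])

text \<open>\<open>ennreal\<close> truncates negative values to zero. The calibrating function in
  \<open>calibrated_beta\<close> takes both signs, whereas the action is an extended nonnegative
  integral.\<close>

lemma ennreal_integral_le:
  assumes "integrable M f"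
  shows "ennreal (LINT x|M. f x) \<le> (\<integral>\<^sup>+ x. ennreal (f x) \<partial>M)"
proof -
  have max_0: "ennreal (max 0 r) = ennreal r" for r
    by (cases "0 \<le> r") (auto simp: max_def ennreal_neg)
  have "(LINT x|M. f x) \<le> (LINT x|M. max 0 (f x))"
    using assms by (intro integral_mono) auto
  then have "ennreal (LINT x|M. f x) \<le> ennreal (LINT x|M. max 0 (f x))"
    by (rule ennreal_leI)
  also have "\<dots> = (\<integral>\<^sup>+ x. ennreal (max 0 (f x)) \<partial>M)"
    using assms by (intro nn_integral_eq_integral[symmetric]) auto
  finally show ?thesis
    by (simp add: max_0)
qed

text \<open>One metric supplies the area and the other the Lagrangian: they coincide in the
  calibration and are conformal in the comparison.\<close>

lemma action_field_measure:
  assumes g: "riemannian_metric g" and g': "riemannian_metric g'" and X: "continuous_on UNIV X"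
  shows "action g' (field_measure g X) = ennreal (LINT p|haar_torus. vol g p / area g * (g' p (X p) (X p) / 2))"
proof -
  note cL = continuous_on_lagrangian[OF g']
  have "action g' (field_measure g X) = (\<integral>\<^sup>+ x. ennreal (case x of (p, v) \<Rightarrow> lagrangian g' p v) \<partial>field_measure g X)"
    by (simp add: action_def case_prod_unfold)
  also have "\<dots> = ennreal (LINT (p, v)|field_measure g X. lagrangian g' p v)"
    by (rule nn_integral_eq_integral[OF field_measure_integral(2)[OF g X cL]])
      (auto simp: lagrangian_def)
  finally show ?thesis
    unfolding field_measure_integral(1)[OF g X cL] by (simp add: lagrangian_eq[OF g'])
qed

lemma metric_diff_square:
  assumes g: "riemannian_metric g"
  shows "g p (v - w) (v - w) = g p v v - 2 * g p w v + g p w w"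
  by (simp add: bilinear_lsub[OF metric_bilinear[OF g]] bilinear_rsub[OF metric_bilinear[OF g]] metric_commute[OF g, of p v w])

context
  fixes g :: metric and X \<kappa> h
  assumes g: "riemannian_metric g" and X: "continuous_on UNIV X" and cl: "closed_form (\<lambda>p. g p (X p))"
    and \<kappa>: "\<And>p. g p (X p) (X p) = \<kappa>"
    and closed: "field_measure g X \<in> closed_measures" and rot: "rotation_vector (field_measure g X) = h"
begin

lemma calibration_period: "pairing (\<lambda>p. g p (X p)) h = \<kappa>"
proof -
  have c: "continuous_on UNIV (\<lambda>(p, v). g p (X p) v)"
    by (intro continuous_on_form closed_formD[OF cl])
  have "pairing (\<lambda>p. g p (X p)) h = (LINT p|haar_torus. vol g p * (\<kappa> / area g))"
    unfolding rot[symmetric] pairing_rotation_vector[OF closed cl]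
    by (simp add: field_measure_integral(1)[OF g X c] \<kappa>)
  also have "\<dots> = \<kappa>"
    using area_pos[OF g] by (simp only: integral_mult_left_zero area_def[symmetric]) simp
  finally show ?thesis .
qed

text \<open>The form dual to \<open>X\<close>, minus \<open>\<kappa> / 2\<close>, is a lower bound
  for the Lagrangian whose integral depends on the class alone, namely
  \<open>\<kappa> - \<kappa> / 2\<close>; the field measure attains it.\<close>

lemma calibrated_beta: "mather_beta g h = ennreal (\<kappa> / 2)"
  unfolding mather_beta_def
proof (rule antisym)
  have "action g (field_measure g X) = ennreal (LINT p|haar_torus. vol g p * (\<kappa> / (2 * area g)))"
    by (simp add: action_field_measure[OF g g X] \<kappa> mult.commute)
  also have "\<dots> = ennreal (\<kappa> / 2)"
    using area_pos[OF g] by (simp only: integral_mult_left_zero area_def[symmetric]) simp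
  finally show "(INF \<mu>\<in>{\<mu> \<in> closed_measures. rotation_vector \<mu> = h}. action g \<mu>) \<le> ennreal (\<kappa> / 2)"
    using closed rot by (metis (mono_tags, lifting) INF_lower mem_Collect_eq)
next
  show "ennreal (\<kappa> / 2) \<le> (INF \<mu>\<in>{\<mu> \<in> closed_measures. rotation_vector \<mu> = h}. action g \<mu>)"
  proof (rule INF_greatest)
    fix \<nu> assume "\<nu> \<in> {\<mu> \<in> closed_measures. rotation_vector \<mu> = h}"
    then have \<nu>: "\<nu> \<in> closed_measures" "rotation_vector \<nu> = h" by auto
    interpret \<nu>: prob_space \<nu> by (rule closed_measure_prob[OF \<nu>(1)])
    have int: "integrable \<nu> (\<lambda>x. g (fst x) (X (fst x)) (snd x))"
      using closed_measure_form_integrable[OF \<nu>(1) closed_formD(1)[OF cl] closed_formD(3)[OF cl]]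
      by (simp add: case_prod_unfold)
    have period: "(LINT x|\<nu>. g (fst x) (X (fst x)) (snd x) - \<kappa> / 2) = \<kappa> / 2"
      using pairing_rotation_vector[OF \<nu>(1) cl] int calibration_period \<nu>(2) by (simp add: case_prod_unfold \<nu>.prob_space)
    have "ennreal (\<kappa> / 2) \<le> (\<integral>\<^sup>+ x. ennreal (g (fst x) (X (fst x)) (snd x) - \<kappa> / 2) \<partial>\<nu>)"
      using ennreal_integral_le[of \<nu> "\<lambda>x. g (fst x) (X (fst x)) (snd x) - \<kappa> / 2"] int
      unfolding period by simp
    also have "\<dots> \<le> action g \<nu>"
      unfolding action_def case_prod_unfold
    proof (rule nn_integral_mono, rule ennreal_leI)
      fix x :: tangent
      \<comment> \<open>Half of the expanded inequality
        \<open>0 \<le> g p (v - X p) (v - X p)\<close>.\<close>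
      show "g (fst x) (X (fst x)) (snd x) - \<kappa> / 2 \<le> lagrangian g (fst x) (snd x)"
        using metric_nonneg[OF g, of "fst x" "snd x - X (fst x)"]
        by (simp add: metric_diff_square[OF g] \<kappa> lagrangian_eq[OF g])
    qed
    finally show "ennreal (\<kappa> / 2) \<le> action g \<nu>" .
  qed
qed

lemma calibrated_nonzero:
  assumes "h \<noteq> 0" shows "0 < \<kappa>"
proof (rule ccontr)
  assume "\<not> 0 < \<kappa>"
  then have "X p = 0" for p
    using metric_pos[OF g, of "X p" p] \<kappa>[of p] by auto
  then have "rotation_vector (field_measure g X) = 0"
    by (simp add: rotation_vector_eq[OF closed] field_measure_integral(1)[OF g X continuous_on_snd[OF continuous_on_id]])
  then show False using rot assms by simp
qed

end

lemma mather_beta_le_action: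
  "\<mu> \<in> closed_measures \<Longrightarrow> mather_beta g (rotation_vector \<mu>) \<le> action g \<mu>"
  unfolding mather_beta_def by (rule INF_lower) simp

lemma mather_beta_mono:
  assumes "\<And>p v. lagrangian g p v \<le> lagrangian g' p v"
  shows "mather_beta g h \<le> mather_beta g' h"
  unfolding mather_beta_def action_def
  by (intro INF_mono' nn_integral_mono) (auto intro!: ennreal_leI assms)

subsection \<open>Conformal metrics\<close>

context
  fixes g g0 :: metric and \<phi> :: "torus \<Rightarrow> real"
  assumes g: "riemannian_metric g" and g0: "riemannian_metric g0"
    and \<phi>: "smooth \<phi>" "\<And>p. 0 < \<phi> p" and conf: "g = (\<lambda>p v w. \<phi> p * g0 p v w)"
begin

lemma vol_conformal: "vol g p = \<phi> p * vol g0 p"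
proof -
  have "det (gram g p) = (\<phi> p)\<^sup>2 * det (gram g0 p)"
    by (simp add: det_2 gram_def conf power2_eq_square algebra_simps)
  then show ?thesis
    using \<phi>(2)[of p] by (simp add: vol_def real_sqrt_mult)
qed

text \<open>The measure of \<open>g0\<close> competes in the minimization for \<open>g\<close>. The
  factor \<phi> of the Lagrangian and the weight \<open>vol g0\<close> combine to
  \<open>vol g\<close>, so the action becomes an area.\<close>

lemma beta_conformal_le:
  assumes "continuous_on UNIV X" "\<And>p. g0 p (X p) (X p) = \<kappa>" "field_measure g0 X \<in> closed_measures"
    "rotation_vector (field_measure g0 X) = h"
  shows "mather_beta g h \<le> ennreal (\<kappa> / 2 * (area g / area g0))"
proof -
  have "mather_beta g h \<le> action g (field_measure g0 X)"
    using mather_beta_le_action[OF assms(3), of g] assms(4) by simp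
  also have "\<dots> = ennreal (LINT p|haar_torus. vol g p * (\<kappa> / (2 * area g0)))"
    unfolding action_field_measure[OF g0 g assms(1)]
    by (simp add: conf assms(2) vol_conformal[unfolded conf] mult.commute mult.left_commute)
  also have "\<dots> = ennreal (\<kappa> / 2 * (area g / area g0))"
    by (simp only: integral_mult_left_zero area_def[symmetric]) (simp add: mult.commute)
  finally show ?thesis .
qed

end

section \<open>Comparison of the two beta functions and rigidity\<close>

theorem corollary9:
  fixes g g0 :: metric
  assumes "riemannian_metric g"
    and "normalized_conformal_flat g g0"
  shows "(\<forall>h. mather_beta g h \<le> mather_beta g0 h) \<and>
         ((\<exists>h. h \<noteq> 0 \<and> mather_beta g h = mather_beta g0 h) \<longleftrightarrow> g = g0) \<and>
         (g = g0 \<longleftrightarrow> flat_metric g)"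
proof -
  note g = assms(1)
  obtain \<phi> p1 where g0: "riemannian_metric g0" and flat0: "flat_metric g0"
    and \<phi>: "smooth \<phi>" "\<And>p. 0 < \<phi> p" and conf: "g = (\<lambda>p v w. \<phi> p * g0 p v w)"
    and \<phi>_le: "\<And>p. \<phi> p \<le> 1" and p1: "\<phi> p1 = 1"
    using assms(2) unfolding normalized_conformal_flat_def by blast
  note area = area_pos[OF g] area_pos[OF g0]
  have le: "mather_beta g h \<le> mather_beta g0 h" for h
  proof (rule mather_beta_mono)
    fix p v
    show "lagrangian g p v \<le> lagrangian g0 p v"
      using mult_right_mono[OF \<phi>_le[of p] metric_nonneg[OF g0, of p v]]
      by (simp add: lagrangian_eq g g0) (simp add: conf)
  qed
  have eq: "g = g0" if "\<And>p. \<phi> p = 1"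
    by (simp add: conf that)
  have "g = g0" if h: "h \<noteq> 0" and \<beta>: "mather_beta g h = mather_beta g0 h" for h
  proof (rule eq)
    obtain X \<kappa> where X: "continuous_on UNIV X" "closed_form (\<lambda>p. g0 p (X p))" "\<And>p. g0 p (X p) (X p) = \<kappa>"
      "field_measure g0 X \<in> closed_measures" "rotation_vector (field_measure g0 X) = h"
      using flat_parallel_field[OF g0 flat0] by blast
    have "ennreal (\<kappa> / 2) \<le> ennreal (\<kappa> / 2 * (area g / area g0))"
      using beta_conformal_le[OF g g0 \<phi> conf X(1,3-)] calibrated_beta[OF g0 X] \<beta> by simp
    moreover have "0 < \<kappa>"
      by (rule calibrated_nonzero[OF g0 X h])
    \<comment> \<open>The condition \<open>h \<noteq> 0\<close> enters through division by \<kappa>;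
      at \<open>h = 0\<close> both values vanish and carry no information.\<close>
    ultimately have "area g0 \<le> area g"
      using area by (simp add: ennreal_le_iff field_simps)
    have c: "continuous_on UNIV (\<lambda>p. vol g0 p - vol g p)"
      by (intro continuous_intros vol_continuous g g0)
    have nonneg: "0 \<le> vol g0 p - vol g p" for p
      using \<phi>_le[of p] vol_pos[OF g0, of p] by (simp add: vol_conformal[OF g g0 \<phi> conf] mult_le_cancel_right1)
    \<comment> \<open>The densities satisfy \<open>vol g \<le> vol g0\<close> pointwise, so equal
      total areas force them to coincide.\<close>
    have "(LINT p|haar_torus. vol g0 p - vol g p) = area g0 - area g"
      unfolding area_def by (intro Bochner_Integration.integral_diff integrable_haar_torus vol_continuous g g0)
    moreover have "0 \<le> (LINT p|haar_torus. vol g0 p - vol g p)"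
      using nonneg by (intro integral_nonneg_AE) simp
    ultimately have "(LINT p|haar_torus. vol g0 p - vol g p) = 0"
      using \<open>area g0 \<le> area g\<close> by simp
    then have "vol g0 p - vol g p = 0" for p
      by (rule haar_torus_continuous_eq_0[OF c nonneg])
    then have "\<phi> p * vol g0 p = 1 * vol g0 p" for p
      by (simp add: vol_conformal[OF g g0 \<phi> conf])
    then show "\<phi> p = 1" for p
      using vol_pos[OF g0, of p] by (metis mult_cancel_right less_irrefl)
  qed
  moreover have "g = g0" if flat: "flat_metric g"
  proof (rule eq)
    \<comment> \<open>Any nonzero class serves; it selects one nonvanishing parallel field for each
      metric.\<close>
    define h :: "real^2" where "h = axis 1 1"
    have h: "h \<noteq> 0" by (simp add: h_def axis_eq_0_iff)
    obtain X0 \<kappa>0 where X0: "continuous_on UNIV X0" "closed_form (\<lambda>p. g0 p (X0 p))" "\<And>p. g0 p (X0 p) (X0 p) = \<kappa>0"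
      "field_measure g0 X0 \<in> closed_measures" "rotation_vector (field_measure g0 X0) = h"
      using flat_parallel_field[OF g0 flat0] by blast
    obtain X1 \<kappa>1 where X1: "continuous_on UNIV X1" "closed_form (\<lambda>p. g p (X1 p))" "\<And>p. g p (X1 p) (X1 p) = \<kappa>1"
      "field_measure g X1 \<in> closed_measures" "rotation_vector (field_measure g X1) = h"
      using flat_parallel_field[OF g flat] by blast
    have pos: "0 < \<kappa>0" "0 < \<kappa>1"
      using calibrated_nonzero[OF g0 X0 h] calibrated_nonzero[OF g X1 h] by auto
    \<comment> \<open>The inverse factor may exceed one, but \<open>beta_conformal_le\<close> asks
      for a smooth positive factor only, so it can be applied in both directions.\<close>
    have inv: "smooth (\<lambda>p. 1 / \<phi> p)" "\<And>p. 0 < 1 / \<phi> p" "g0 = (\<lambda>p v w. 1 / \<phi> p * g p v w)"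
      using \<phi>(2) by (auto simp: conf less_imp_neq[symmetric] intro!: smooth_divide \<phi> smooth_const)
    have "ennreal (\<kappa>1 / 2) \<le> ennreal (\<kappa>0 / 2 * (area g / area g0))"
      using beta_conformal_le[OF g g0 \<phi> conf X0(1,3-)] by (simp only: calibrated_beta[OF g X1])
    then have 1: "\<kappa>1 * area g0 \<le> \<kappa>0 * area g"
      using pos area by (simp add: ennreal_le_iff field_simps)
    have "ennreal (\<kappa>0 / 2) \<le> ennreal (\<kappa>1 / 2 * (area g0 / area g))"
      using beta_conformal_le[OF g0 g inv X1(1,3-)] by (simp only: calibrated_beta[OF g0 X0])
    then have 2: "\<kappa>0 * area g \<le> \<kappa>1 * area g0"
      using pos area by (simp add: ennreal_le_iff field_simps)
    \<comment> \<open>The left side is twice the \<open>g\<close>-action of the measure carried by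
      \<open>X0\<close>, the right side twice \<open>mather_beta g h\<close>: the measure is
      minimizing for \<open>g\<close> as well.\<close>
    have \<kappa>: "\<kappa>0 * area g / area g0 = \<kappa>1"
      using 1 2 area by (simp add: field_simps)
    \<comment> \<open>The squared \<open>g\<close>-distance of \<open>X0\<close> from
      \<open>X1\<close>, weighted by the normalized area of \<open>g0\<close>. Its integral is twice
      the defect in the calibration inequality,
      \<open>\<kappa>0 * area g / area g0 - 2 * \<kappa>1 + \<kappa>1\<close>, which is
      zero.\<close>
    define E where "E p = vol g0 p / area g0 * g p (X0 p - X1 p) (X0 p - X1 p)" for p
    have c: "continuous_on UNIV (\<lambda>(p, v). g p (X1 p) v)"
      by (intro continuous_on_form closed_formD[OF X1(2)])
    have c1: "continuous_on UNIV (\<lambda>p. vol g0 p / area g0 * g p (X1 p) (X0 p))"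
      using area by (intro continuous_intros continuous_on_metric[OF g] X0 X1 vol_continuous g0) auto
    have cE: "continuous_on UNIV E"
      unfolding E_def using area by (intro continuous_intros continuous_on_metric[OF g] X0 X1 vol_continuous g0) auto
    have E0: "0 \<le> E p" for p
      using vol_pos[OF g0, of p] area metric_nonneg[OF g] by (simp add: E_def)
    \<comment> \<open>Both field measures lie in the class \<open>h\<close>, so the closed form
      calibrating \<open>g\<close> has the same integral on either of them.\<close>
    have period: "\<kappa>1 = (LINT p|haar_torus. vol g0 p / area g0 * g p (X1 p) (X0 p))"
      using calibration_period[OF g X1] pairing_rotation_vector[OF X0(4) X1(2)]
      by (simp add: X0(5) field_measure_integral(1)[OF g0 X0(1) c])
    have "E p = vol g p * (\<kappa>0 / area g0) - 2 * (vol g0 p / area g0 * g p (X1 p) (X0 p)) + vol g0 p * (\<kappa>1 / area g0)" for p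
    proof -
      have "g p (X0 p) (X0 p) = \<phi> p * \<kappa>0"
        by (simp add: conf X0(3))
      then show ?thesis
        unfolding E_def metric_diff_square[OF g] X1(3) vol_conformal[OF g g0 \<phi> conf] by (simp add: algebra_simps add_divide_distrib)
    qed
    moreover have int: "integrable haar_torus (\<lambda>p. vol g p * (\<kappa>0 / area g0))"
      "integrable haar_torus (\<lambda>p. 2 * (vol g0 p / area g0 * g p (X1 p) (X0 p)))"
      "integrable haar_torus (\<lambda>p. vol g0 p * (\<kappa>1 / area g0))"
      by (intro integrable_haar_torus continuous_on_mult continuous_on_const vol_continuous g g0 c1)+
    ultimately have "(LINT p|haar_torus. E p) = (LINT p|haar_torus. vol g p * (\<kappa>0 / area g0))
      - (LINT p|haar_torus. 2 * (vol g0 p / area g0 * g p (X1 p) (X0 p))) + (LINT p|haar_torus. vol g0 p * (\<kappa>1 / area g0))"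
      by (simp only: Bochner_Integration.integral_add Bochner_Integration.integral_diff Bochner_Integration.integrable_diff)
    then have "(LINT p|haar_torus. E p) = 0"
      using area \<kappa> period by (simp only: integral_mult_right_zero integral_mult_left_zero area_def[symmetric]) (simp add: mult.commute)
    then have E_eq: "E p = 0" for p
      by (rule haar_torus_continuous_eq_0[OF cE E0])
    have "X0 p = X1 p" for p
    proof (rule ccontr)
      assume "X0 p \<noteq> X1 p"
      then have "0 < g p (X0 p - X1 p) (X0 p - X1 p)"
        by (intro metric_pos[OF g]) simp
      then have "0 < E p"
        unfolding E_def by (intro mult_pos_pos divide_pos_pos vol_pos g0 area)
      then show False by (simp add: E_eq)
    qed
    \<comment> \<open>The common field has constant length for both metrics, so \<phi> is constant,
      and its value at \<open>p1\<close> is one.\<close>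
    then have "\<phi> p * \<kappa>0 = \<kappa>1" for p
      using X1(3)[of p] X0(3)[of p] by (simp add: conf)
    then show "\<phi> p = 1" for p
      using p1 pos by (metis mult_cancel_right less_irrefl)
  qed
  moreover have "\<exists>h. h \<noteq> 0 \<and> mather_beta g h = mather_beta g0 h" if "g = g0"
    using that axis_eq_0_iff[of 1 "1::real"] by (metis zero_neq_one)
  ultimately show ?thesis
    using le flat0 by blast
qed

end
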